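(* Let $q'=q^{q-1}$, $\mathbf{s}=(s_1,\dots,s_r)$ with all $s_i\geq1$, $\boldsymbol{\epsilon}=(\epsilon_1,\dots,\epsilon_r)\in(\mathbb{F}_q^\times)^r$, and let $\gamma_1,\dots,\gamma_r\in\mathbb{F}_{q'}$ satisfy $\gamma_i^{q-1}=\epsilon_i$; put $\boldsymbol{\gamma}=(\gamma_1,\dots,\gamma_r)$. (1) For every monic irreducible $P\in A$ with $P\nmid\Gamma_{s_i}$ for $1\leq i\leq r$, the congruence \[ \zeta_{\mathcal{A}_k}(\mathbf{s};\boldsymbol{\epsilon})_P\equiv\frac{1}{\gamma_1\Gamma_{s_1}\cdots\gamma_r\Gamma_{s_r}}\sum_{\mathbf{j}\in\mathfrak{J}_{\mathbf{s}}}\theta^{\mathbf{j}}\sum_{d=r-1}^{\deg P-1}\frac{BC_{q^d-1}^{\mathbf{s},\boldsymbol{\gamma},\mathbf{j}}}{L_dBC_{q^d-1}} \] holds in $A'/(P)$. (2) Let $r'\in\mathbb{N}$, $\bar{\mathbf{s}}=(1,\dots,1,s_1,\dots,s_r)\in\mathbb{N}^{r+r'}$ and $\bar{\boldsymbol{\epsilon}}=(1,\dots,1,\epsilon_1,\dots,\epsilon_r)\in(\mathbb{F}_q^\times)^{r+r'}$ (with $r'$ leading $1$'s). Then for every monic irreducible $P\in A$ with $P\nmid\Gamma_{s_i}$ for $1\leq i\leq r$, \[ \zeta_{\mathcal{A}_k}(\bar{\mathbf{s}};\bar{\boldsymbol{\epsilon}})_P\equiv\frac{1}{\gamma_1\Gamma_{s_1}\cdots\gamma_r\Gamma_{s_r}}\sum_{\mathbf{j}\in\mathfrak{J}_{\mathbf{s}}}\theta^{\mathbf{j}}\sum_{\deg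 P>d_0>\cdots>d_{r'}\geq r-1}\frac{BC_{q^{d_{r'}}-1}^{\mathbf{s},\boldsymbol{\gamma},\mathbf{j}}}{L_{d_0}\cdots L_{d_{r'}}BC_{q^{d_{r'}}-1}} \] in $A'/(P)$.
   Context: Fix a prime $p$ and a power $q$ of $p$; $A=\mathbb{F}_q[\theta]$, $k=\mathbb{F}_q(\theta)$, $A'=\mathbb{F}_{q'}[\theta]$. For $n\geq1$, $[n]=\theta^{q^n}-\theta$, $D_n=[n]^{q^0}[n-1]^{q^1}\cdots[1]^{q^{n-1}}$, $L_n=(-1)^n[n]\cdots[1]$, $D_0=L_0=1$; for $n=\sum_j\alpha_jq^j$ ($0\leq\alpha_j<q$), $\Pi(n)=\prod_jD_j^{\alpha_j}$, $\Gamma_{n+1}=\Pi(n)$. $e_C(z)=\sum_{i\geq0}z^{q^i}/D_i$; $\mathrm{Li}_{\mathbf{s}}(z_1,\dots,z_r)=\sum_{i_1>\cdots>i_r\geq0}\frac{z_1^{q^{i_1}}\cdots z_r^{q^{i_r}}}{L_{i_1}^{s_1}\cdots L_{i_r}^{s_r}}$. Anderson–Thakur polynomials: with $G_n(t,y)=\prod_{i=1}^n(t^{q^n}-y^{q^i})$, define $\mathfrak{H}_n(t,y)$ by $\sum_{n\geq0}\frac{\mathfrak{H}_n(t,y)}{\Gamma_{n+1}|_{\theta=t}}x^n=\left(1-\sum_{i\geq0}\frac{G_i(t,y)}{D_i|_{\theta=t}}x^{q^i}\right)^{-1}$, $H_n(t)=\mathfrak{H}_n(t,\theta)=\sum_{j=0}^{m_{n+1}}u_{n+1,j}t^j\in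 A[t]$, $m_{n+1}=\deg_tH_n$. $\mathfrak{J}_{\mathbf{s}}=\{(j_1,\dots,j_r)\in\mathbb{N}^r:0\leq j_i\leq\deg_tH_{s_i-1}\}$, $\theta^{\mathbf{j}}=\theta^{j_1+\cdots+j_r}$. $BC_n^{\mathbf{s},\boldsymbol{\gamma},\mathbf{j}}\in\bar{k}$ is defined by $\sum_{n\geq0}BC_n^{\mathbf{s},\boldsymbol{\gamma},\mathbf{j}}\frac{z^n}{\Pi(n)}=\frac{\mathrm{Li}_{\mathbf{s}}(e_C(z)\gamma_1u_{s_1,j_1},\gamma_2u_{s_2,j_2},\dots,\gamma_ru_{s_r,j_r})}{e_C(z)}$. The Bernoulli–Carlitz numbers $BC_n\in k$ are defined by $\frac{z}{e_C(z)}=\sum_{n\geq0}BC_n\frac{z^n}{\Pi(n)}$. For monic irreducible $P\in A$, $\zeta_{\mathcal{A}_k}(\mathbf{s};\boldsymbol{\epsilon})_P=\sum\frac{\epsilon_1^{\deg a_1}\cdots\epsilon_r^{\deg a_r}}{a_1^{s_1}\cdots a_r^{s_r}}\in A/(P)$, summed over monic $a_i\in A$ with $\deg P>\deg a_1>\cdots>\deg a_r\geq0$; $A/(P)$ is regarded inside $A'/(P)=A'/PA'$. *)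

theory Defs
  imports "HOL-Computational_Algebra.Computational_Algebra" "HOL-Library.Cardinality"
    "HOL-Analysis.Infinite_Sum"
begin

text \<open>
  The Carlitz quantities are defined over an arbitrary ring with a distinguished element \<open>x\<close>:
  taking \<open>x\<close> to be \<open>\<theta>\<close> gives the usual quantities, and taking \<open>x\<close> to be \<open>t\<close> gives the
  specialisation \<open>\<theta> = t\<close>.
\<close>

definition carlitz_bracket :: "nat \<Rightarrow> 'a::comm_ring_1 \<Rightarrow> nat \<Rightarrow> 'a" where
  "carlitz_bracket q x n = x ^ (q ^ n) - x"

definition carlitz_D :: "nat \<Rightarrow> 'a::comm_ring_1 \<Rightarrow> nat \<Rightarrow> 'a" where
  "carlitz_D q x n = (\<Prod>i<n. carlitz_bracket q x (n - i) ^ (q ^ i))"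

definition carlitz_L :: "nat \<Rightarrow> 'a::comm_ring_1 \<Rightarrow> nat \<Rightarrow> 'a" where
  "carlitz_L q x n = (- 1) ^ n * (\<Prod>i=1..n. carlitz_bracket q x i)"

text \<open>\<open>(n div q ^ j) mod q\<close> is the \<open>j\<close>-th base-\<open>q\<close> digit of \<open>n\<close>; it vanishes for \<open>j > n\<close>.\<close>

definition carlitz_Pi :: "nat \<Rightarrow> 'a::comm_ring_1 \<Rightarrow> nat \<Rightarrow> 'a" where
  "carlitz_Pi q x n = (\<Prod>j\<le>n. carlitz_D q x j ^ ((n div q ^ j) mod q))"

definition carlitz_Gamma :: "nat \<Rightarrow> 'a::comm_ring_1 \<Rightarrow> nat \<Rightarrow> 'a" where
  "carlitz_Gamma q x n = carlitz_Pi q x (n - 1)"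

text \<open>The power series \<open>\<Sum>i\<ge>0. c i * z ^ (q ^ i)\<close>, for \<open>q \<ge> 2\<close>.\<close>

definition q_power_series :: "nat \<Rightarrow> (nat \<Rightarrow> 'a::comm_ring_1) \<Rightarrow> 'a fps" where
  "q_power_series q c = Abs_fps (\<lambda>n. \<Sum>i | q ^ i = n. c i)"

definition carlitz_exp :: "nat \<Rightarrow> 'a::field \<Rightarrow> 'a fps" where
  "carlitz_exp q x = q_power_series q (\<lambda>i. 1 / carlitz_D q x i)"

definition bernoulli_carlitz :: "nat \<Rightarrow> 'a::field \<Rightarrow> nat \<Rightarrow> 'a" where
  "bernoulli_carlitz q x n = carlitz_Pi q x n * fps_nth (fps_X / carlitz_exp q x) n"

text \<open>
  The infinite sum is taken in the \<open>z\<close>-adic topology of the ring of formal power series.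
  It converges as soon as the first argument has no constant term.
\<close>

definition carlitz_polylog ::
    "nat \<Rightarrow> 'a::field \<Rightarrow> nat list \<Rightarrow> 'a fps list \<Rightarrow> 'a fps" where
  "carlitz_polylog q x s zs =
     (\<Sum>\<^sub>\<infinity>is\<in>{is. length is = length s \<and> sorted_wrt (>) is}.
        \<Prod>k<length s. (zs ! k) ^ (q ^ (is ! k)) * fps_const (1 / carlitz_L q x (is ! k) ^ (s ! k)))"

text \<open>
  Anderson--Thakur polynomials.  Polynomials in \<open>t\<close> with coefficients in \<open>F\<^sub>q[y]\<close> have type
  \<open>'a poly poly\<close>, the outer variable being \<open>t\<close>; so \<open>F\<^sub>q(t,y)\<close> is \<open>'a poly poly fract\<close>.
  Since \<open>\<theta>\<close> is transcendental, substituting \<open>y = \<theta>\<close> is just a renaming of the inner variable,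
  and \<open>AT_poly q n\<close> is an element of \<open>A[t]\<close>.
\<close>

definition AT_G :: "nat \<Rightarrow> 'a::comm_ring_1 \<Rightarrow> 'a \<Rightarrow> nat \<Rightarrow> 'a" where
  "AT_G q t y n = (\<Prod>i=1..n. t ^ (q ^ n) - y ^ (q ^ i))"

definition AT_frac :: "nat \<Rightarrow> nat \<Rightarrow> 'a::field poly poly fract" where
  "AT_frac q n =
     (let t = to_fract [:0, 1:]; y = to_fract [:[:0, 1:]:]
      in carlitz_Gamma q t (n + 1) *
         fps_nth (inverse (1 - q_power_series q (\<lambda>i. AT_G q t y i / carlitz_D q t i))) n)"

text \<open>The denominators in \<open>t\<close> of \<open>AT_frac q n\<close> cancel when the base field has \<open>q\<close> elements.\<close>

definition AT_poly :: "nat \<Rightarrow> nat \<Rightarrow> 'a::field poly poly" where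
  "AT_poly q n = (THE h. to_fract h = AT_frac q n)"

definition AT_coeff :: "nat \<Rightarrow> nat \<Rightarrow> nat \<Rightarrow> 'a::field poly" where
  "AT_coeff q n j = coeff (AT_poly q (n - 1)) j"

definition AT_indices :: "'a::field itself \<Rightarrow> nat \<Rightarrow> nat list \<Rightarrow> nat list set" where
  "AT_indices _ q s =
     {js. length js = length s \<and>
          (\<forall>i<length s. js ! i \<le> degree (AT_poly q (s ! i - 1) :: 'a poly poly))}"

text \<open>
  In the following, \<open>\<iota>\<close> is the embedding of \<open>F\<^sub>q\<close> into its extension \<open>F\<^sub>q\<^sub>'\<close>, and \<open>k\<close> is
  regarded inside \<open>k' = F\<^sub>q\<^sub>'(\<theta>)\<close>.
\<close>

definition field_embedding :: "('a::field \<Rightarrow> 'b::field) \<Rightarrow> bool" where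
  "field_embedding \<iota> \<longleftrightarrow>
     \<iota> 1 = 1 \<and> (\<forall>x y. \<iota> (x + y) = \<iota> x + \<iota> y) \<and> (\<forall>x y. \<iota> (x * y) = \<iota> x * \<iota> y)"

definition theta_frac :: "'b::field poly fract" where
  "theta_frac = to_fract [:0, 1:]"

text \<open>The numbers \<open>BC\<close> attached to \<open>s\<close>, \<open>\<gamma>\<close> and \<open>j\<close>; they lie in \<open>k'\<close>.\<close>

definition multi_bernoulli_carlitz ::
    "nat \<Rightarrow> ('a::field \<Rightarrow> 'b::field) \<Rightarrow> nat list \<Rightarrow> 'b list \<Rightarrow> nat list \<Rightarrow> nat \<Rightarrow> 'b poly fract" where
  "multi_bernoulli_carlitz q \<iota> s \<gamma> js n =
     (let E = carlitz_exp q theta_frac;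
          c = (\<lambda>i. to_fract (smult (\<gamma> ! i) (map_poly \<iota> (AT_coeff q (s ! i) (js ! i)))));
          zs = map (\<lambda>i. if i = 0 then E * fps_const (c i) else fps_const (c i)) [0..<length s]
      in carlitz_Pi q theta_frac n * fps_nth (carlitz_polylog q theta_frac s zs / E) n)"

text \<open>
  Elements of \<open>A/(P)\<close> are represented by their remainders modulo \<open>P\<close>.
\<close>

definition inverse_mod :: "'a::field poly \<Rightarrow> 'a poly \<Rightarrow> 'a poly" where
  "inverse_mod P a = (THE b. b mod P = b \<and> (a * b) mod P = 1 mod P)"

definition finite_mzv :: "nat list \<Rightarrow> 'a::field list \<Rightarrow> 'a poly \<Rightarrow> 'a poly" where
  "finite_mzv s \<epsilon> P =
     (\<Sum>as \<in> {as. length as = length s \<and> (\<forall>a\<in>set as. lead_coeff a = 1) \<and>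
                   sorted_wrt (>) (degree P # map degree as)}.
        \<Prod>i<length s. [:\<epsilon> ! i:] ^ degree (as ! i) * inverse_mod P (as ! i) ^ (s ! i)) mod P"

text \<open>
  Congruence in \<open>A'/(Q)\<close> between fractions whose denominators can be chosen coprime to \<open>Q\<close>; such
  fractions have a well-defined residue class.
\<close>

definition integral_at :: "'b::field poly \<Rightarrow> 'b poly fract \<Rightarrow> bool" where
  "integral_at Q x \<longleftrightarrow> (\<exists>a b. b \<noteq> 0 \<and> coprime b Q \<and> x = to_fract a / to_fract b)"

definition fract_cong :: "'b::field poly \<Rightarrow> 'b poly fract \<Rightarrow> 'b poly fract \<Rightarrow> bool" where
  "fract_cong Q x y \<longleftrightarrow>
     integral_at Q x \<and> integral_at Q y \<and> (\<exists>z. integral_at Q z \<and> x - y = to_fract Q * z)"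

end

theory Submission
  imports Defs
begin

text \<open>
  Both sides of the congruence come from one and the same element of \<open>k'\<close>: the right-hand side equals
  the truncated multiple zeta value \<open>\<Sum> \<epsilon>\<^sub>1 ^ deg a\<^sub>1 \<cdots> / (a\<^sub>1 ^ s\<^sub>1 \<cdots>)\<close>, which is integral at \<open>P\<close> and
  reduces to \<open>\<zeta>(s; \<epsilon>)\<^sub>P\<close>.  The coefficient of \<open>z ^ (q ^ d - 1)\<close> in \<open>e\<^sub>C(z) ^ (q ^ m - 1)\<close> is \<open>1\<close> for
  \<open>m = d\<close> and \<open>0\<close> otherwise, so passing to this coefficient in the polylogarithm divided by \<open>e\<^sub>C\<close> picks
  the terms with \<open>i\<^sub>1 = d\<close>; for \<open>z / e\<^sub>C(z) = \<Sum>\<^sub>m e\<^sub>C(z) ^ (q ^ m - 1) / L\<^sub>m\<close> it gives \<open>1 / L\<^sub>d\<close>.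
  Summation over \<open>j\<close> then evaluates Anderson--Thakur polynomials, and
  \<open>\<Sum>\<^sub>j u\<^sub>j ^ (q ^ d) \<theta> ^ j = \<Gamma>\<^sub>s L\<^sub>d ^ s \<Sum>\<^sub>a 1 / a ^ s\<close> (\<open>a\<close> monic of degree \<open>d\<close>) follows by
  taking the logarithmic derivative of \<open>\<Prod>\<^sub>a (X - a)\<close>, whose coefficients are known from Carlitz' formula.
\<close>

text \<open>The sum over j evaluates H at two unlike points. Raising a coefficient in F_q[\<theta>]
  to the power q^d moves \<theta> to \<theta>^(q^d), while the factors \<theta>^j stay put; so t =
  \<theta> and y = \<theta>^(q^d). There G_i / D_i turns into L_d^(q^i) times the i-th coefficient
  of Carlitz' polynomial psi_d, and the defining series of the Anderson-Thakur polynomials becomes 1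
  / (1 - psi_d(L_d x)). Up to scaling this is the logarithmic derivative of 1 - psi_d(X), whose
  roots are the monic polynomials of degree d. The obstacle is that H is defined in a fraction
  field, where y cannot simply be specialised. An integral recursion preserved by all ring
  homomorphisms replaces the definition; it rests on the integrality of \<Pi>(m+n) / (\<Pi>(m)
  \<Pi>(n)), which follows from a Legendre-type formula for \<Pi>. In the reduction modulo P, the
  polynomial P may become reducible over F_q'. Bezout identities over F_q survive the extension of
  constants, and all inverses are taken from them.\<close>

section \<open>The Carlitz factorial\<close>

lemma less_power_self:
  fixes q n :: nat
  assumes "q \<ge> 2"
  shows "n < q ^ n"
proof -
  have "n < 2 ^ n" by (rule less_exp)
  also have "2 ^ n \<le> q ^ n" using assms by (rule power_mono) simp
  finally show ?thesis .
qed

text \<open>A digit at a position j < e contributes nothing, and these low digits together stay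
  below q^e; every higher digit carries a multiple of q^e. So dividing digit by digit loses
  nothing.\<close>

lemma sum_digits_mult_div:
  fixes q n e N :: nat
  assumes "q \<ge> 2"
  shows "(\<Sum>j<N. (q ^ j div q ^ e) * ((n div q ^ j) mod q)) = (n mod q ^ N) div q ^ e"
proof (induction N)
  case 0
  then show ?case by simp
next
  case (Suc N)
  have eq: "n mod q ^ Suc N = q ^ N * ((n div q ^ N) mod q) + n mod q ^ N"
    by (simp only: power_Suc2 mod_mult2_eq)
  show ?case
  proof (cases "e \<le> N")
    case True
    then have "q ^ N = q ^ e * q ^ (N - e)"
      by (simp flip: power_add)
    then have "(n mod q ^ Suc N) div q ^ e
        = (n mod q ^ N + q ^ e * (q ^ (N - e) * ((n div q ^ N) mod q))) div q ^ e"
      by (subst eq) (simp only: mult.assoc add.commute)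
    also have "\<dots> = q ^ (N - e) * ((n div q ^ N) mod q) + (n mod q ^ N) div q ^ e"
      using assms by simp
    also have "q ^ (N - e) = q ^ N div q ^ e"
      using assms True by (simp add: power_diff)
    finally show ?thesis using Suc.IH by simp
  next
    case False
    then have "q ^ Suc N \<le> q ^ e" "q ^ N < q ^ e"
      using assms False by (auto intro!: power_increasing simp del: power_Suc)
    moreover have "n mod q ^ Suc N < q ^ Suc N" "n mod q ^ N < q ^ N"
      using assms by (intro mod_less_divisor; simp)+
    ultimately show ?thesis using Suc.IH by simp
  qed
qed

lemma carlitz_D_conv_prod:
  "carlitz_D q x i = (\<Prod>e=1..i. carlitz_bracket q x e ^ (q ^ (i - e)))"
  unfolding carlitz_D_def
  by (rule prod.reindex_bij_witness[of _ "\<lambda>e. i - e" "\<lambda>j. i - j"]) auto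

lemma carlitz_D_conv_prod_div:
  assumes "q \<ge> 2" "i \<le> N"
  shows "carlitz_D q x i = (\<Prod>e=1..N. carlitz_bracket q x e ^ (q ^ i div q ^ e))"
proof -
  have "(\<Prod>e=1..N. carlitz_bracket q x e ^ (q ^ i div q ^ e))
      = (\<Prod>e=1..i. carlitz_bracket q x e ^ (q ^ i div q ^ e))"
    using assms by (intro prod.mono_neutral_right) auto
  also have "\<dots> = carlitz_D q x i"
    using assms by (auto simp: carlitz_D_conv_prod power_diff intro!: prod.cong)
  finally show ?thesis by simp
qed

text \<open>The analogue of Legendre's formula for n!: [e] occurs in D_j with exponent
  \<open>q ^ j div q ^ e\<close>, and weighting by the digits of n adds up to
  \<open>n div q ^ e\<close>. The bound N is free so that products for m, n and m + n can share one
  range.\<close>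

lemma carlitz_Pi_conv_prod:
  assumes q: "q \<ge> 2" and "n \<le> N"
  shows "carlitz_Pi q x n = (\<Prod>e=1..N. carlitz_bracket q x e ^ (n div q ^ e))"
proof -
  have "carlitz_Pi q x n
      = (\<Prod>j\<le>n. \<Prod>e=1..N. carlitz_bracket q x e ^ ((q ^ j div q ^ e) * ((n div q ^ j) mod q)))"
    unfolding carlitz_Pi_def using assms
    by (intro prod.cong refl) (simp add: carlitz_D_conv_prod_div[of q _ N] prod_power_distrib power_mult)
  also have "\<dots> = (\<Prod>e=1..N. \<Prod>j\<le>n. carlitz_bracket q x e ^ ((q ^ j div q ^ e) * ((n div q ^ j) mod q)))"
    by (rule prod.swap)
  also have "\<dots> = (\<Prod>e=1..N. carlitz_bracket q x e ^ (n div q ^ e))"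
  proof (intro prod.cong refl)
    fix e
    \<comment> \<open>Reduction modulo q^(n+1) leaves n unchanged, so the digits up to position n
      suffice.\<close>
    have "n < q ^ Suc n"
      using less_power_self[OF q, of "Suc n"] by linarith
    then have "(\<Sum>j\<le>n. (q ^ j div q ^ e) * ((n div q ^ j) mod q)) = n div q ^ e"
      using sum_digits_mult_div[OF q, where N = "Suc n" and e = e and n = n] by (simp only: lessThan_Suc_atMost mod_less)
    then show "(\<Prod>j\<le>n. carlitz_bracket q x e ^ ((q ^ j div q ^ e) * ((n div q ^ j) mod q)))
        = carlitz_bracket q x e ^ (n div q ^ e)"
      by (simp flip: power_sum)
  qed
  finally show ?thesis .
qed

lemma carlitz_Pi_power:
  assumes "q \<ge> 2"
  shows "carlitz_Pi q x (q ^ i) = carlitz_D q x i"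
  using assms carlitz_Pi_conv_prod[of q "q ^ i" "q ^ i + i" x] carlitz_D_conv_prod_div[of q i "q ^ i + i" x]
  by simp

lemma carlitz_Pi_0: "carlitz_Pi q x 0 = 1"
  by (simp add: carlitz_Pi_def carlitz_D_def)

text \<open>This is \<Pi>(m+n) / (\<Pi>(m) \<Pi>(n)), written without division so that it makes
  sense in every commutative ring and commutes with homomorphisms. Floors are superadditive, so the
  truncated subtraction in the exponents cuts nothing off.\<close>

definition carlitz_binomial :: "nat \<Rightarrow> 'a::comm_ring_1 \<Rightarrow> nat \<Rightarrow> nat \<Rightarrow> 'a" where
  "carlitz_binomial q x m n =
     (\<Prod>e=1..m+n. carlitz_bracket q x e ^ ((m + n) div q ^ e - m div q ^ e - n div q ^ e))"

lemma carlitz_Pi_add: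
  assumes "q \<ge> 2"
  shows "carlitz_Pi q x (m + n) = carlitz_binomial q x m n * (carlitz_Pi q x m * carlitz_Pi q x n)"
proof -
  have le: "m div k + n div k \<le> (m + n) div k" for k
    by (subst div_add1_eq) (rule le_add1)
  have eq: "c - a - b + (a + b) = c" if "a + b \<le> c" for a b c :: nat
    using that by linarith
  have split: "z ^ ((m + n) div k)
      = z ^ ((m + n) div k - m div k - n div k) * (z ^ (m div k) * z ^ (n div k))" for z :: 'a and k
    by (simp only: power_add[symmetric] eq[OF le])
  have "carlitz_Pi q x (m + n) = (\<Prod>e=1..m+n. carlitz_bracket q x e ^ ((m + n) div q ^ e))"
    by (rule carlitz_Pi_conv_prod[OF assms]) simp
  also have "\<dots> = (\<Prod>e=1..m+n. carlitz_bracket q x e ^ ((m + n) div q ^ e - m div q ^ e - n div q ^ e) *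
      (carlitz_bracket q x e ^ (m div q ^ e) * carlitz_bracket q x e ^ (n div q ^ e)))"
    by (rule prod.cong[OF refl split])
  also have "\<dots> = carlitz_binomial q x m n * (carlitz_Pi q x m * carlitz_Pi q x n)"
    by (simp add: carlitz_binomial_def prod.distrib carlitz_Pi_conv_prod[OF assms, of m "m + n"]
        carlitz_Pi_conv_prod[OF assms, of n "m + n"])
  finally show ?thesis .
qed

section \<open>Ring homomorphisms\<close>

locale comm_ring_map =
  fixes f :: "'a::comm_ring_1 \<Rightarrow> 'b::comm_ring_1"
  assumes map_one: "f 1 = 1"
    and map_add: "f (x + y) = f x + f y"
    and map_mult: "f (x * y) = f x * f y"
begin

lemma map_zero: "f 0 = 0"
  using map_add[of 0 0] by simp

lemma map_uminus: "f (- x) = - f x"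
  using map_add[of x "- x"] by (simp add: map_zero eq_neg_iff_add_eq_0 add.commute)

lemma map_diff: "f (x - y) = f x - f y"
  using map_add[of x "- y"] by (simp add: map_uminus)

lemma map_power: "f (x ^ n) = f x ^ n"
  by (induction n) (simp_all add: map_one map_mult)

lemma map_sum: "f (sum g S) = (\<Sum>x\<in>S. f (g x))"
  by (induction S rule: infinite_finite_induct) (simp_all add: map_zero map_add)

lemma map_prod: "f (prod g S) = (\<Prod>x\<in>S. f (g x))"
  by (induction S rule: infinite_finite_induct) (simp_all add: map_one map_mult)

lemma map_bracket: "f (carlitz_bracket q x n) = carlitz_bracket q (f x) n"
  by (simp add: carlitz_bracket_def map_diff map_power)

lemma map_carlitz_binomial: "f (carlitz_binomial q x m n) = carlitz_binomial q (f x) m n"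
  by (simp add: carlitz_binomial_def map_prod map_power map_bracket)

lemma map_AT_G: "f (AT_G q t y n) = AT_G q (f t) (f y) n"
  by (simp add: AT_G_def map_prod map_power map_diff)

lemma map_poly_map: "comm_ring_map (map_poly f)"
proof
  show "map_poly f (x * y) = map_poly f x * map_poly f y" for x y
    by (rule poly_eqI) (simp add: coeff_map_poly map_zero coeff_mult map_sum map_mult)
  show "map_poly f (x + y) = map_poly f x + map_poly f y" for x y
    by (rule poly_eqI) (simp add: coeff_map_poly map_zero map_add)
qed (simp add: map_one)

end

lemma comm_ring_map_comp:
  assumes "comm_ring_map f" "comm_ring_map g"
  shows "comm_ring_map (\<lambda>x. g (f x))"
proof -
  interpret f: comm_ring_map f by fact
  interpret g: comm_ring_map g by fact
  show ?thesis
    by unfold_locales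
      (simp_all add: f.map_one g.map_one f.map_add g.map_add f.map_mult g.map_mult)
qed

lemma comm_ring_map_to_fract: "comm_ring_map to_fract"
  by unfold_locales simp_all

lemma comm_ring_map_poly: "comm_ring_map (\<lambda>p. poly p x)"
  by unfold_locales simp_all

section \<open>Anderson--Thakur polynomials\<close>

lemma q_power_series_nth: "fps_nth (q_power_series q c) n = (\<Sum>i | q ^ i = n. c i)"
  by (simp add: q_power_series_def)

lemma finite_power_eq: "q \<ge> 2 \<Longrightarrow> finite {i. q ^ i = (n::nat)}"
proof -
  assume "q \<ge> 2"
  show ?thesis
    by (rule finite_subset[of _ "{..n}"]) (auto intro: less_imp_le[OF less_power_self[OF \<open>q \<ge> 2\<close>]])
qed

text \<open>Compare coefficients in F = a + C F, where C has no constant term because q^i is never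
  0. This serves the Anderson-Thakur series with a = 1 and the series of power sums with a = 1 /
  L_d.\<close>

lemma fps_recursion:
  fixes F :: "'a::comm_ring_1 fps"
  assumes "q \<ge> 2" and "(1 - q_power_series q c) * F = fps_const a"
  shows "fps_nth F 0 = a"
    and "n > 0 \<Longrightarrow> fps_nth F n = (\<Sum>k=1..n. (\<Sum>i | q ^ i = k. c i) * fps_nth F (n - k))"
proof -
  have C0: "(\<Sum>i | q ^ i = 0. c i) = 0"
    using assms by simp
  have "(1 - q_power_series q c) * F + q_power_series q c * F = F"
    by (simp add: left_diff_distrib)
  then have "F = fps_const a + q_power_series q c * F"
    unfolding assms(2) by (rule sym)
  then have "fps_nth F n = fps_nth (fps_const a + q_power_series q c * F) n" for n
    by (rule arg_cong)
  also have "fps_nth (fps_const a + q_power_series q c * F) n = (if n = 0 then a else 0) +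
      (\<Sum>k=0..n. (\<Sum>i | q ^ i = k. c i) * fps_nth F (n - k))" for n
    by (simp only: fps_add_nth fps_nth_fps_const fps_mult_nth q_power_series_nth)
  finally have *: "fps_nth F n = (if n = 0 then a else 0) +
      (\<Sum>k=0..n. (\<Sum>i | q ^ i = k. c i) * fps_nth F (n - k))" for n .
  show "fps_nth F 0 = a"
    using C0 by (subst *) simp
  show "fps_nth F n = (\<Sum>k=1..n. (\<Sum>i | q ^ i = k. c i) * fps_nth F (n - k))" if "n > 0"
    using C0 that by (subst *) (simp add: sum.atLeast_Suc_atMost)
qed

text \<open>
  The recursion for the coefficients of \<open>1 / (1 - \<Sum>i. G\<^sub>i / D\<^sub>i x ^ (q ^ i))\<close>, multiplied by
  \<open>\<Pi>(n)\<close>.  The quotients \<open>\<Pi>(n) / (\<Pi>(k) \<Pi>(n - k))\<close> being integral, it involves no denominators.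
\<close>

function AT_rec :: "nat \<Rightarrow> 'a::comm_ring_1 \<Rightarrow> 'a \<Rightarrow> nat \<Rightarrow> 'a" where
  "AT_rec q t y n = (if n = 0 then 1 else
     (\<Sum>k=1..n. (\<Sum>i | q ^ i = k. carlitz_binomial q t k (n - k) * AT_G q t y i) * AT_rec q t y (n - k)))"
  by auto
termination
  by (relation "measure (\<lambda>(q, t, y, n). n)") auto

declare AT_rec.simps [simp del]

lemma (in comm_ring_map) map_AT_rec: "f (AT_rec q t y n) = AT_rec q (f t) (f y) n"
proof (induction n rule: less_induct)
  case (less n)
  then have "f (AT_rec q t y (n - k)) = AT_rec q (f t) (f y) (n - k)" if "k \<in> {1..n}" for k
    using that by simp
  then show ?case
    unfolding AT_rec.simps[of q t y n] AT_rec.simps[of q "f t" "f y" n]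
    by (auto simp: map_one map_sum map_mult map_carlitz_binomial map_AT_G intro!: sum.cong)
qed

lemma carlitz_D_neq_0:
  fixes x :: "'a::field"
  assumes "\<And>e. e > 0 \<Longrightarrow> carlitz_bracket q x e \<noteq> 0"
  shows "carlitz_D q x n \<noteq> 0"
  using assms by (simp add: carlitz_D_def)

lemma carlitz_Pi_neq_0:
  fixes x :: "'a::field"
  assumes "\<And>e. e > 0 \<Longrightarrow> carlitz_bracket q x e \<noteq> 0"
  shows "carlitz_Pi q x n \<noteq> 0"
  using carlitz_D_neq_0[OF assms] by (simp add: carlitz_Pi_def)

text \<open>Multiplying the recursion for w by \<Pi>(n) clears its denominators: the inner sum is
  nonempty only for k = q^i, where \<Pi>(k) = D_i, and \<Pi>(n) / (D_i \<Pi>(n-k)) is the Carlitz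
  binomial. It is applied to the Anderson-Thakur series itself and to rescaled power sums.\<close>

lemma AT_rec_eqI:
  fixes t y :: "'a::field"
  assumes q: "q \<ge> 2" and nz: "\<And>e. e > 0 \<Longrightarrow> carlitz_bracket q t e \<noteq> 0"
    and w0: "w 0 = 1"
    and w: "\<And>n. n > 0 \<Longrightarrow> w n = (\<Sum>k=1..n. (\<Sum>i | q ^ i = k. AT_G q t y i / carlitz_D q t i) * w (n - k))"
  shows "AT_rec q t y n = carlitz_Pi q t n * w n"
proof (induction n rule: less_induct)
  case (less n)
  show ?case
  proof (cases "n = 0")
    case True
    then show ?thesis using w0 by (simp add: AT_rec.simps carlitz_Pi_0)
  next
    case False
    have "(\<Sum>i | q ^ i = k. carlitz_binomial q t k (n - k) * AT_G q t y i) * AT_rec q t y (n - k)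
        = carlitz_Pi q t n * ((\<Sum>i | q ^ i = k. AT_G q t y i / carlitz_D q t i) * w (n - k))"
      if k: "k \<in> {1..n}" for k
    proof -
      have IH: "AT_rec q t y (n - k) = carlitz_Pi q t (n - k) * w (n - k)"
        using less k by simp
      have "carlitz_binomial q t k (n - k) * AT_G q t y i * (carlitz_Pi q t (n - k) * w (n - k))
          = carlitz_Pi q t n * (AT_G q t y i / carlitz_D q t i * w (n - k))" if "q ^ i = k" for i
      proof -
        have "carlitz_Pi q t n = carlitz_binomial q t k (n - k) * (carlitz_D q t i * carlitz_Pi q t (n - k))"
          using carlitz_Pi_add[OF q, of t k "n - k"] carlitz_Pi_power[OF q, of t i] k that by simp
        then show ?thesis
          using carlitz_D_neq_0[OF nz, of i] by simp
      qed
      then show ?thesis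
        by (simp add: IH sum_distrib_left sum_distrib_right)
    qed
    then show ?thesis
      using False by (simp add: AT_rec.simps[of q t y n] w[of n] sum_distrib_left)
  qed
qed

lemma bracket_monom_neq_0:
  assumes "q \<ge> 2" "e > 0"
  shows "carlitz_bracket q ([:0, 1:] :: 'a::idom poly) e \<noteq> 0"
proof -
  have "q ^ e \<noteq> 1"
    using assms by (metis less_numeral_extra(4) less_le_trans one_less_numeral_iff one_less_power semiring_norm(76))
  then have "degree ([:0, 1 :: 'a:] ^ (q ^ e)) \<noteq> degree [:0, 1 :: 'a:]"
    by (simp add: degree_power_eq)
  then show ?thesis
    unfolding carlitz_bracket_def by (metis eq_iff_diff_eq_0)
qed

text \<open>The recursion, run in the polynomial ring and then embedded, gives
  \<open>AT_frac\<close>; hence the definite description in \<open>AT_poly\<close> denotes, and H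
  becomes accessible to substitutions.\<close>

lemma AT_poly_eq_AT_rec:
  assumes "q \<ge> 2"
  shows "AT_poly q n = (AT_rec q [:0, 1:] [:[:0, 1:]:] n :: 'a::field poly poly)"
proof -
  interpret comm_ring_map "to_fract :: 'a poly poly \<Rightarrow> _"
    by (rule comm_ring_map_to_fract)
  let ?t = "to_fract [:0, 1 :: 'a poly:]" and ?y = "to_fract [:[:0, 1 :: 'a:]:]"
  define c where "c = (\<lambda>i. AT_G q ?t ?y i / carlitz_D q ?t i)"
  define F where "F = inverse (1 - q_power_series q c)"
  have nz: "carlitz_bracket q ?t e \<noteq> 0" if "e > 0" for e
    using bracket_monom_neq_0[OF assms that, where 'a = "'a poly"]
    by (simp flip: map_bracket)
  have "fps_nth (1 - q_power_series q c) 0 = 1"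
    using assms by (simp add: q_power_series_nth)
  then have F: "(1 - q_power_series q c) * F = fps_const 1"
    unfolding F_def by (subst mult.commute) (simp add: inverse_mult_eq_1)
  have "AT_rec q ?t ?y n = carlitz_Pi q ?t n * fps_nth F n"
  proof (rule AT_rec_eqI[OF assms nz])
    show "fps_nth F 0 = 1"
      by (rule fps_recursion(1)[OF assms F])
    show "fps_nth F n = (\<Sum>k=1..n. (\<Sum>i | q ^ i = k. AT_G q ?t ?y i / carlitz_D q ?t i) * fps_nth F (n - k))"
      if "n > 0" for n
      using fps_recursion(2)[OF assms F that] by (simp add: c_def)
  qed
  then have "AT_frac q n = to_fract (AT_rec q [:0, 1 :: 'a poly:] [:[:0, 1 :: 'a:]:] n)"
    by (simp add: AT_frac_def Let_def carlitz_Gamma_def F_def c_def map_AT_rec)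
  then show ?thesis
    unfolding AT_poly_def by simp
qed

section \<open>Carlitz identities\<close>

lemma carlitz_D_Suc: "carlitz_D q x (Suc i) = carlitz_bracket q x (Suc i) * carlitz_D q x i ^ q"
  by (simp only: carlitz_D_def prod.lessThan_Suc_shift)
    (simp add: prod_power_distrib power_mult mult.commute[of q])

lemma carlitz_D_0 [simp]: "carlitz_D q x 0 = 1"
  by (simp add: carlitz_D_def)

lemma carlitz_L_0 [simp]: "carlitz_L q x 0 = 1"
  by (simp add: carlitz_L_def)

lemma carlitz_L_Suc: "carlitz_L q x (Suc i) = (x - x ^ (q ^ Suc i)) * carlitz_L q x i"
  by (simp add: carlitz_L_def carlitz_bracket_def algebra_simps)

lemma carlitz_L_add:
  "carlitz_L q x (n + i) = carlitz_L q x n * (\<Prod>k=1..i. x - x ^ (q ^ (n + k)))"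
proof (induction i)
  case (Suc i)
  have "carlitz_L q x (n + Suc i) = (x - x ^ (q ^ Suc (n + i))) * carlitz_L q x (n + i)"
    by (simp only: add_Suc_right carlitz_L_Suc)
  then show ?case by (simp only: Suc.IH) (simp add: ac_simps)
qed simp

section \<open>Carlitz' relations between D_i and L_i, and the polynomials psi_d\<close>

locale carlitz_field =
  fixes q :: nat and \<theta> :: "'k::field"
  assumes char_power: "\<exists>e\<ge>1. q = CHAR('k) ^ e"
    and prime_char: "prime CHAR('k)"
    and bracket_neq_0: "n > 0 \<Longrightarrow> carlitz_bracket q \<theta> n \<noteq> 0"
begin

abbreviation "D \<equiv> carlitz_D q \<theta>"
abbreviation "L \<equiv> carlitz_L q \<theta>"

lemma q_ge_2: "q \<ge> 2"
proof -
  obtain e where e: "e \<ge> 1" "q = CHAR('k) ^ e" using char_power by blast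
  have "CHAR('k) ^ 1 \<le> CHAR('k) ^ e"
    using e prime_gt_0_nat[OF prime_char] by (intro power_increasing) auto
  then show ?thesis
    using e prime_ge_2_nat[OF prime_char] by simp
qed

lemma of_nat_q: "of_nat q = (0::'k)"
proof -
  obtain e where e: "e \<ge> 1" "q = CHAR('k) ^ e" using char_power by blast
  then show ?thesis by simp
qed

lemma q_power_char: "\<exists>e. q ^ n = CHAR('k) ^ e"
  using char_power by (metis power_mult)

lemma frob_sum: "(\<Sum>x\<in>S. g x :: 'k) ^ (q ^ n) = (\<Sum>x\<in>S. g x ^ (q ^ n))"
  using q_power_char[of n] freshmans_dream_sum'[OF prime_char] by metis

lemma frob_sum_1: "(\<Sum>x\<in>S. g x :: 'k) ^ q = (\<Sum>x\<in>S. g x ^ q)"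
  using frob_sum[of _ _ 1] by simp

lemma frob_add: "(x + y :: 'k) ^ (q ^ n) = x ^ (q ^ n) + y ^ (q ^ n)"
  using q_power_char[of n] freshmans_dream'[OF prime_char] by metis

lemma frob_diff: "(x - y :: 'k) ^ (q ^ n) = x ^ (q ^ n) - y ^ (q ^ n)"
  using frob_add[of "x - y" y n] by (simp add: eq_diff_eq)

lemma L_neq_0: "L n \<noteq> 0"
  using bracket_neq_0 by (simp add: carlitz_L_def)

lemma Pi_neq_0: "carlitz_Pi q \<theta> n \<noteq> 0"
  by (rule carlitz_Pi_neq_0) (rule bracket_neq_0)

text \<open>Insert \<theta>^(q^i) between the two terms of the bracket. The last summand of the
  first half and the summand i = 0 of the second vanish. In the applications each half then cancels
  one bracket of a denominator.\<close>

lemma bracket_split: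
  "(\<Sum>i\<le>Suc m. (\<theta> ^ (q ^ Suc m) - \<theta>) * g i) =
   (\<Sum>i\<le>m. (\<theta> ^ (q ^ Suc m) - \<theta> ^ (q ^ i)) * g i) + (\<Sum>i\<le>m. (\<theta> ^ (q ^ Suc i) - \<theta>) * g (Suc i))"
proof -
  have "(\<theta> ^ (q ^ Suc m) - \<theta>) * g i
      = (\<theta> ^ (q ^ Suc m) - \<theta> ^ (q ^ i)) * g i + (\<theta> ^ (q ^ i) - \<theta>) * g i" for i
    by (simp add: algebra_simps)
  then have "(\<Sum>i\<le>Suc m. (\<theta> ^ (q ^ Suc m) - \<theta>) * g i)
      = (\<Sum>i\<le>Suc m. (\<theta> ^ (q ^ Suc m) - \<theta> ^ (q ^ i)) * g i) + (\<Sum>i\<le>Suc m. (\<theta> ^ (q ^ i) - \<theta>) * g i)"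
    by (simp only: sum.distrib)
  also have "(\<Sum>i\<le>Suc m. (\<theta> ^ (q ^ Suc m) - \<theta> ^ (q ^ i)) * g i)
      = (\<Sum>i\<le>m. (\<theta> ^ (q ^ Suc m) - \<theta> ^ (q ^ i)) * g i)"
    by (subst sum.atMost_Suc) (simp only: diff_self mult_zero_left add_0_right)
  also have "(\<Sum>i\<le>Suc m. (\<theta> ^ (q ^ i) - \<theta>) * g i) = (\<Sum>i\<le>m. (\<theta> ^ (q ^ Suc i) - \<theta>) * g (Suc i))"
    by (subst sum.atMost_Suc_shift)
      (simp only: power_0 power_one_right diff_self mult_zero_left add_0_left)
  finally show ?thesis .
qed

lemma bracket_neq_0': "\<theta> ^ (q ^ Suc m) - \<theta> \<noteq> 0"
  using bracket_neq_0[of "Suc m", OF zero_less_Suc] by (simp only: carlitz_bracket_def not_False_eq_True)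

lemma bracket_frob:
  assumes "i \<le> m"
  shows "\<theta> ^ (q ^ m) - \<theta> ^ (q ^ i) = (\<theta> ^ (q ^ (m - i)) - \<theta>) ^ (q ^ i)"
  using assms by (simp add: frob_diff flip: power_mult power_add)

text \<open>This is the coefficient of z^(q^d) in log(e_C(z)), where log(z) is the sum of z^(q^i) /
  L_i. For d > 0 multiply by [d] and split: one half cancels the top bracket of D_(d-i), the other
  that of L_i, and what remains differs only in sign.\<close>

lemma log_exp_coeff: "(\<Sum>i\<le>d. 1 / (L i * D (d - i) ^ (q ^ i))) = (if d = 0 then 1 else 0)"
proof (cases d)
  case (Suc m)
  let ?g = "\<lambda>i. 1 / (L i * D (Suc m - i) ^ (q ^ i))"
  have cancel: "b * (1 / (x * (b * y))) = 1 / (x * y)" if "b \<noteq> 0" for b x y :: 'k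
    using that by simp
  have A: "(\<theta> ^ (q ^ Suc m) - \<theta> ^ (q ^ i)) * ?g i = 1 / (L i * D (m - i) ^ (q ^ Suc i))"
    if "i \<le> m" for i
  proof -
    let ?b = "\<theta> ^ (q ^ Suc (m - i)) - \<theta>"
    have "\<theta> ^ (q ^ Suc m) - \<theta> ^ (q ^ i) = ?b ^ (q ^ i)"
      using bracket_frob[of i "Suc m"] that by (simp only: Suc_diff_le le_SucI)
    moreover have "D (Suc m - i) ^ (q ^ i) = ?b ^ (q ^ i) * D (m - i) ^ (q ^ Suc i)"
      using that
      by (simp only: Suc_diff_le carlitz_D_Suc carlitz_bracket_def power_mult_distrib power_mult[symmetric] power_Suc)
    moreover have "?b ^ (q ^ i) \<noteq> 0"
      using bracket_neq_0' power_not_zero by blast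
    ultimately show ?thesis
      by (simp only: cancel not_False_eq_True)
  qed
  have B: "(\<theta> ^ (q ^ Suc i) - \<theta>) * ?g (Suc i) = - (1 / (L i * D (m - i) ^ (q ^ Suc i)))" for i
  proof -
    let ?b = "\<theta> - \<theta> ^ (q ^ Suc i)"
    have "?g (Suc i) = 1 / (?b * (L i * D (m - i) ^ (q ^ Suc i)))"
      by (simp only: carlitz_L_Suc diff_Suc_Suc mult.assoc)
    moreover have "?b \<noteq> 0"
      using bracket_neq_0'[of i] by auto
    moreover have "\<theta> ^ (q ^ Suc i) - \<theta> = - ?b"
      by simp
    moreover have "- b * (1 / (b * x)) = - (1 / x)" if "b \<noteq> 0" for b x :: 'k
      using that by simp
    ultimately show ?thesis by metis
  qed
  have A': "(\<Sum>i\<le>m. (\<theta> ^ (q ^ Suc m) - \<theta> ^ (q ^ i)) * ?g i) = (\<Sum>i\<le>m. 1 / (L i * D (m - i) ^ (q ^ Suc i)))"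
    by (intro sum.cong refl A) simp
  have "(\<theta> ^ (q ^ Suc m) - \<theta>) * (\<Sum>i\<le>Suc m. ?g i) = 0"
    by (simp only: sum_distrib_left bracket_split B sum_negf A' right_minus diff_self add_uminus_conv_diff)
  then show ?thesis
    using bracket_neq_0'[of m] Suc by (simp del: power_Suc)
qed simp

text \<open>The opposite composition e_C(log(z)). After multiplication by [d] the two halves are -S
  and S^q, with S the sum for d - 1; by induction S is 0 or 1, so they cancel.\<close>

lemma exp_log_coeff: "(\<Sum>i\<le>d. 1 / (D i * L (d - i) ^ (q ^ i))) = (if d = 0 then 1 else 0)"
proof (induction d)
  case (Suc m)
  let ?g = "\<lambda>i. 1 / (D i * L (Suc m - i) ^ (q ^ i))"
  have cancel: "- b * (1 / (x * (b * y))) = - (1 / (x * y))" if "b \<noteq> 0" for b x y :: 'k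
    using that by simp
  have A: "(\<theta> ^ (q ^ Suc m) - \<theta> ^ (q ^ i)) * ?g i = - (1 / (D i * L (m - i) ^ (q ^ i)))"
    if "i \<le> m" for i
  proof -
    let ?b = "\<theta> - \<theta> ^ (q ^ Suc (m - i))"
    have "\<theta> ^ (q ^ Suc m) - \<theta> ^ (q ^ i) = (- ?b) ^ (q ^ i)"
      using bracket_frob[of i "Suc m"] that by (simp only: Suc_diff_le le_SucI minus_diff_eq)
    also have "\<dots> = - (?b ^ (q ^ i))"
      using frob_diff[of 0 ?b i] q_ge_2 by simp
    finally have "\<theta> ^ (q ^ Suc m) - \<theta> ^ (q ^ i) = - (?b ^ (q ^ i))" .
    moreover have "L (Suc m - i) ^ (q ^ i) = ?b ^ (q ^ i) * L (m - i) ^ (q ^ i)"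
      using that by (simp only: Suc_diff_le carlitz_L_Suc power_mult_distrib)
    moreover have "?b ^ (q ^ i) \<noteq> 0"
      using bracket_neq_0'[of "m - i"] by (metis right_minus_eq power_not_zero)
    ultimately show ?thesis
      by (simp only: cancel not_False_eq_True)
  qed
  have B: "(\<theta> ^ (q ^ Suc i) - \<theta>) * ?g (Suc i) = (1 / (D i * L (m - i) ^ (q ^ i))) ^ q" for i
  proof -
    let ?b = "\<theta> ^ (q ^ Suc i) - \<theta>"
    have "D (Suc i) * L (Suc m - Suc i) ^ (q ^ Suc i) = ?b * (D i * L (m - i) ^ (q ^ i)) ^ q"
      by (simp only: carlitz_D_Suc carlitz_bracket_def diff_Suc_Suc mult.assoc power_mult_distrib power_Suc2 power_mult)
    then show ?thesis
      using bracket_neq_0'[of i] by (simp add: power_divide del: power_Suc)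
  qed
  have A': "(\<Sum>i\<le>m. (\<theta> ^ (q ^ Suc m) - \<theta> ^ (q ^ i)) * ?g i) = - (\<Sum>i\<le>m. 1 / (D i * L (m - i) ^ (q ^ i)))"
    unfolding sum_negf[symmetric] by (intro sum.cong refl A) simp
  have "(\<theta> ^ (q ^ Suc m) - \<theta>) * (\<Sum>i\<le>Suc m. ?g i)
      = - (\<Sum>i\<le>m. 1 / (D i * L (m - i) ^ (q ^ i))) + (\<Sum>i\<le>m. 1 / (D i * L (m - i) ^ (q ^ i))) ^ q"
    by (simp only: sum_distrib_left bracket_split B frob_sum_1 A')
  also have "\<dots> = 0"
    using q_ge_2 by (simp only: Suc.IH) simp
  finally show ?case
    using bracket_neq_0'[of m] by (simp del: power_Suc)
qed simp

text \<open>This is \<open>\<Prod>\<^sub>a (x - a) / D\<^sub>d\<close> over all \<open>a \<in> A\<close> of degree below \<open>d\<close>, in Carlitz' explicit form.\<close>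

definition psi :: "nat \<Rightarrow> 'k \<Rightarrow> 'k" where
  "psi d x = (\<Sum>i\<le>d. x ^ (q ^ i) / (D i * L (d - i) ^ (q ^ i)))"

lemma psi_sum: "psi d (\<Sum>x\<in>S. g x) = (\<Sum>x\<in>S. psi d (g x))"
  by (simp add: psi_def frob_sum sum_divide_distrib) (rule sum.swap)

lemma psi_scale:
  assumes "c ^ q = c"
  shows "psi d (c * x) = c * psi d x"
proof -
  have "c ^ (q ^ i) = c" for i
    by (induction i) (simp_all add: assms power_mult)
  then show ?thesis
    by (simp add: psi_def power_mult_distrib sum_distrib_left)
qed

text \<open>The difference of the terms with \<theta> is a sum with factors \<theta>^(q^i) -
  \<theta> = [i], and [i] is exactly what D_i has beyond D_(i-1)^q; the rest is a q-th
  power.\<close>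

lemma psi_theta: "psi (Suc m) (\<theta> * x) = \<theta> * psi (Suc m) x + psi m x ^ q"
proof -
  let ?c = "\<lambda>i. x ^ (q ^ i) / (D i * L (Suc m - i) ^ (q ^ i))"
  have B: "(\<theta> ^ (q ^ Suc i) - \<theta>) * ?c (Suc i) = (x ^ (q ^ i) / (D i * L (m - i) ^ (q ^ i))) ^ q" for i
  proof -
    let ?b = "\<theta> ^ (q ^ Suc i) - \<theta>"
    have "D (Suc i) * L (Suc m - Suc i) ^ (q ^ Suc i) = ?b * (D i * L (m - i) ^ (q ^ i)) ^ q"
      by (simp only: carlitz_D_Suc carlitz_bracket_def diff_Suc_Suc mult.assoc power_mult_distrib power_Suc2 power_mult)
    moreover have "x ^ (q ^ Suc i) = (x ^ (q ^ i)) ^ q"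
      by (simp only: power_Suc2 power_mult)
    ultimately show ?thesis
      using bracket_neq_0'[of i] by (simp add: power_divide del: power_Suc)
  qed
  have "psi (Suc m) (\<theta> * x) - \<theta> * psi (Suc m) x = (\<Sum>i\<le>Suc m. (\<theta> ^ (q ^ i) - \<theta>) * ?c i)"
    by (simp only: psi_def sum_distrib_left sum_subtractf[symmetric] power_mult_distrib)
      (simp only: left_diff_distrib times_divide_eq_right diff_divide_distrib)
  also have "\<dots> = (\<Sum>i\<le>m. (\<theta> ^ (q ^ Suc i) - \<theta>) * ?c (Suc i))"
    by (subst sum.atMost_Suc_shift)
      (simp only: power_0 power_one_right diff_self mult_zero_left add_0_left)
  also have "\<dots> = psi m x ^ q"
    by (simp only: B psi_def frob_sum_1)
  finally show ?thesis by (simp add: algebra_simps)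
qed

text \<open>The case j = 0 is \<open>exp_log_coeff\<close>. The functional equation
  \<open>psi_theta\<close> then lowers j and d together, its linear term vanishing because j - 1 <
  d.\<close>

lemma psi_theta_power: "j \<le> d \<Longrightarrow> psi d (\<theta> ^ j) = (if j = d then 1 else 0)"
proof (induction j arbitrary: d)
  case 0
  then show ?case using exp_log_coeff[of d] by (simp add: psi_def)
next
  case (Suc j)
  then obtain m where m: "d = Suc m" by (cases d) auto
  then show ?case
    using Suc psi_theta[of m "\<theta> ^ j"] q_ge_2 by (simp add: zero_power)
qed

end

section \<open>Monic polynomials of fixed degree and their power sums\<close>

lemma finite_field_power_card:
  fixes c :: "'a::{field,finite}"
  shows "c ^ CARD('a) = c"
proof (cases "c = 0")
  case True
  then show ?thesis by (simp add: zero_power card_gt_0_iff)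
next
  case False
  have "(\<Prod>x\<in>UNIV - {0}. c * x) = (\<Prod>x\<in>UNIV - {0}. x)"
    by (rule prod.reindex_bij_witness[of _ "\<lambda>x. x / c" "\<lambda>x. c * x"]) (use False in auto)
  then have "c ^ (CARD('a) - 1) = 1"
    by (simp add: prod.distrib)
  moreover have "CARD('a) = Suc (CARD('a) - 1)"
    by (simp add: card_gt_0_iff)
  ultimately show ?thesis
    by (metis mult.right_neutral power_Suc)
qed

definition monics :: "nat \<Rightarrow> 'a::field poly set" where
  "monics d = {a. lead_coeff a = 1 \<and> degree a = d}"

lemma monics_0: "monics 0 = {1}"
  by (auto simp: monics_def elim!: degree_eq_zeroE)

lemma monics_Suc: "monics (Suc d) = (\<lambda>(c, a). pCons c a) ` (UNIV \<times> monics d)"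
proof (intro equalityI subsetI)
  fix a :: "'a poly" assume a: "a \<in> monics (Suc d)"
  obtain c b where cb: "a = pCons c b" by (cases a) auto
  then have "b \<in> monics d" using a by (auto simp: monics_def split: if_splits)
  then show "a \<in> (\<lambda>(c, a). pCons c a) ` (UNIV \<times> monics d)" using cb by auto
qed (auto simp: monics_def)

lemma finite_monics: "finite (monics d :: 'a::{field,finite} poly set)"
  by (induction d) (simp_all add: monics_0 monics_Suc)

lemma card_monics: "card (monics d :: 'a::{field,finite} poly set) = CARD('a) ^ d"
proof (induction d)
  case (Suc d)
  have "inj_on (\<lambda>(c, a :: 'a poly). pCons c a) (UNIV \<times> monics d)"
    by (auto simp: inj_on_def)
  then show ?case
    by (simp add: monics_Suc card_image card_cartesian_product Suc.IH)
qed (simp add: monics_0)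

text \<open>The target field is kept apart from the fraction field of A, since it also has to hold
  the roots \<gamma>_i. Only constants coming from A are known to be fixed by the q-th
  power.\<close>

locale carlitz_embedding = carlitz_field q \<theta> + comm_ring_map \<phi>
  for q :: nat and \<theta> :: "'k::field" and \<phi> :: "'a::{field,finite} poly \<Rightarrow> 'k" +
  assumes card_base: "CARD('a) = q"
    and map_X: "\<phi> [:0, 1:] = \<theta>"
    and map_eq_0: "\<phi> p = 0 \<Longrightarrow> p = 0"
begin

lemma map_inj: "\<phi> a = \<phi> b \<longleftrightarrow> a = b"
  using map_eq_0[of "a - b"] by (auto simp: map_diff)

lemma map_conv_sum: "\<phi> p = (\<Sum>i\<le>degree p. \<phi> [:coeff p i:] * \<theta> ^ i)"
proof -
  have "\<phi> (monom c i) = \<phi> [:c:] * \<theta> ^ i" for c i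
    by (simp add: monom_altdef flip: map_mult map_X map_power)
  then show ?thesis
    by (subst poly_as_sum_of_monoms[of p, symmetric]) (simp add: map_sum)
qed

lemma map_const_power: "\<phi> [:c:] ^ q = \<phi> [:c:]"
  using finite_field_power_card[of c] by (simp add: card_base poly_const_pow flip: map_power)

text \<open>\<open>psi d\<close> is linear over F_q and kills the powers of \<theta> below the d-th,
  so it sees only the leading coefficient.\<close>

lemma psi_monic:
  assumes "a \<in> monics d"
  shows "psi d (\<phi> a) = 1"
proof -
  have deg: "degree a = d" and lc: "coeff a d = 1"
    using assms by (auto simp: monics_def)
  have "psi d (\<phi> a) = (\<Sum>i\<le>d. \<phi> [:coeff a i:] * psi d (\<theta> ^ i))"
    by (subst map_conv_sum) (simp add: deg psi_sum psi_scale map_const_power)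
  also have "\<dots> = (\<Sum>i\<le>d. \<phi> [:coeff a i:] * (if i = d then 1 else 0))"
    by (intro sum.cong refl) (simp add: psi_theta_power)
  also have "\<dots> = 1"
    using lc map_one by (subst sum.mono_neutral_right[of _ "{d}"]) (auto simp: one_pCons)
  finally show ?thesis .
qed

definition power_sum :: "nat \<Rightarrow> nat \<Rightarrow> 'k" where
  "power_sum d n = (\<Sum>a\<in>monics d. 1 / \<phi> a ^ n)"

text \<open>The value 0 beyond d makes the associated power series a polynomial and matches the
  vanishing of G_i at y = \<theta>^(q^d) for i > d.\<close>

definition psi_coeff :: "nat \<Rightarrow> nat \<Rightarrow> 'k" where
  "psi_coeff d i = (if i \<le> d then 1 / (D i * L (d - i) ^ (q ^ i)) else 0)"

text \<open>This is 1 - psi_d(X); by \<open>psi_monic\<close> the monic polynomials of degree d are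
  among its roots.\<close>

definition psi_poly :: "nat \<Rightarrow> 'k poly" where
  "psi_poly d = 1 - (\<Sum>i\<le>d. monom (psi_coeff d i) (q ^ i))"

lemma poly_psi_poly: "poly (psi_poly d) x = 1 - psi d x"
  by (simp add: psi_poly_def psi_def psi_coeff_def poly_sum poly_monom)

lemma degree_psi_poly_le: "degree (psi_poly d) \<le> q ^ d"
proof -
  have "degree (monom (psi_coeff d i) (q ^ i)) \<le> q ^ d" if "i \<in> {..d}" for i
    using that q_ge_2 by (intro order.trans[OF degree_monom_le] power_increasing) auto
  then show ?thesis
    unfolding psi_poly_def by (intro degree_diff_le degree_sum_le) auto
qed

lemma power_inj: "q ^ i = q ^ j \<longleftrightarrow> i = j"
  using q_ge_2 by simp

lemma lead_coeff_psi_poly: "coeff (psi_poly d) (q ^ d) = - 1 / D d"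
  using q_ge_2 by (simp add: psi_poly_def coeff_sum power_inj psi_coeff_def sum.delta)

text \<open>Both sides have degree at most q^d, the same coefficient there, and vanish at the q^d
  distinct images of the monic polynomials of degree d.\<close>

lemma psi_poly_eq: "psi_poly d = smult (- 1 / D d) (\<Prod>a\<in>monics d. [:- \<phi> a, 1:])"
proof (rule poly_eqI_degree_lead_coeff)
  let ?P = "\<Prod>a\<in>monics d. [:- \<phi> a, 1:]"
  have deg: "degree ?P = q ^ d"
    by (subst degree_prod_eq_sum_degree) (simp_all add: card_monics card_base)
  have lc: "lead_coeff ?P = 1"
    by (simp add: lead_coeff_prod)
  show "degree (psi_poly d) \<le> q ^ d"
    by (rule degree_psi_poly_le)
  show "degree (smult (- 1 / D d) ?P) \<le> q ^ d"
    by (rule order.trans[OF degree_smult_le]) (simp only: deg)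
  show "coeff (psi_poly d) (q ^ d) = coeff (smult (- 1 / D d) ?P) (q ^ d)"
    using lc by (simp only: lead_coeff_psi_poly coeff_smult deg mult_1_right)
  show "card (\<phi> ` monics d) \<ge> q ^ d"
    by (simp add: card_image inj_on_def map_inj card_monics card_base)
  show "poly (psi_poly d) x = poly (smult (- 1 / D d) ?P) x" if "x \<in> \<phi> ` monics d" for x
  proof -
    from that obtain a where a: "x = \<phi> a" "a \<in> monics d" by (rule imageE)
    then have "poly ?P x = 0"
      by (auto simp: poly_prod finite_monics)
    then show ?thesis
      using a by (simp add: poly_psi_poly psi_monic)
  qed
qed

lemma pderiv_psi_poly: "pderiv (psi_poly d) = [:- 1 / L d:]"
proof -
  have "pderiv (monom (psi_coeff d i) (q ^ i)) = (if i = 0 then [:1 / L d:] else 0)" for i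
    using of_nat_q q_ge_2 by (simp add: pderiv_monom psi_coeff_def zero_power monom_0)
  then show ?thesis
    by (simp add: psi_poly_def pderiv_diff higher_pderiv_sum[of 1, simplified] sum.delta)
qed

text \<open>This is the logarithmic derivative of \<open>psi_poly d\<close>, whose derivative is constant in characteristic \<open>p\<close>.\<close>

lemma power_sum_generating:
  "(1 - q_power_series q (psi_coeff d)) * Abs_fps (\<lambda>n. power_sum d (Suc n)) = fps_const (1 / L d)"
proof -
  \<comment> \<open>\<open>F a\<close> is 1 / (a - X) expanded at 0. Multiplying it by the product
    of all linear factors removes the factor of a, and the sum over a of these products is the
    derivative up to a constant.\<close>
  define F where "F a = Abs_fps (\<lambda>n. 1 / \<phi> a ^ Suc n)" for a
  let ?l = "\<lambda>a. fps_of_poly [:- \<phi> a, 1:]"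
  have F: "?l a * F a = - 1" if "a \<in> monics d" for a
  proof -
    have "\<phi> a \<noteq> 0" using that map_eq_0[of a] by (auto simp: monics_def)
    moreover have "?l a = fps_X - fps_const (\<phi> a)"
      by (subst fps_of_poly_linear) simp
    moreover have "(fps_X - fps_const (\<phi> a)) * F a = - 1"
    proof (rule fps_ext)
      show "fps_nth ((fps_X - fps_const (\<phi> a)) * F a) n = fps_nth (- 1) n" for n
        using \<open>\<phi> a \<noteq> 0\<close> by (cases n) (simp_all add: F_def left_diff_distrib)
    qed
    ultimately show ?thesis by (simp only:)
  qed
  have "1 - q_power_series q (psi_coeff d) = fps_of_poly (psi_poly d)"
  proof (rule fps_ext)
    fix n
    have "(\<Sum>i | q ^ i = n. psi_coeff d i) = (\<Sum>i\<in>{i. q ^ i = n} \<inter> {..d}. psi_coeff d i)"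
      by (rule sum.mono_neutral_right) (auto simp: psi_coeff_def finite_power_eq q_ge_2)
    also have "\<dots> = (\<Sum>i\<le>d. if q ^ i = n then psi_coeff d i else 0)"
      by (subst Int_commute) (simp add: sum.inter_restrict)
    finally show "fps_nth (1 - q_power_series q (psi_coeff d)) n = fps_nth (fps_of_poly (psi_poly d)) n"
      by (simp add: q_power_series_nth psi_poly_def coeff_sum)
  qed
  moreover have "Abs_fps (\<lambda>n. power_sum d (Suc n)) = (\<Sum>a\<in>monics d. F a)"
    by (rule fps_ext) (simp add: fps_sum_nth F_def power_sum_def)
  moreover have "fps_of_poly (psi_poly d) * F a
      = fps_of_poly (smult (1 / D d) (\<Prod>b\<in>monics d - {a}. [:- \<phi> b, 1:]))" if "a \<in> monics d" for a
  proof -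
    have "psi_poly d = smult (- 1 / D d) ((\<Prod>b\<in>monics d - {a}. [:- \<phi> b, 1:]) * [:- \<phi> a, 1:])"
      using that by (simp only: psi_poly_eq prod.remove[OF finite_monics] mult.commute)
    then have "fps_of_poly (psi_poly d) * F a
      = fps_of_poly (smult (- 1 / D d) (\<Prod>b\<in>monics d - {a}. [:- \<phi> b, 1:])) * (?l a * F a)"
      by (simp only: mult_smult_left[symmetric] fps_of_poly_mult mult.assoc)
    then show ?thesis
      by (simp only: F[OF that]) (simp flip: fps_of_poly_uminus)
  qed
  ultimately have "(1 - q_power_series q (psi_coeff d)) * Abs_fps (\<lambda>n. power_sum d (Suc n))
      = fps_of_poly (\<Sum>a\<in>monics d. smult (1 / D d) (\<Prod>b\<in>monics d - {a}. [:- \<phi> b, 1:]))"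
    by (simp only: sum_distrib_left fps_of_poly_sum) (simp cong: sum.cong)
  also have "(\<Sum>a\<in>monics d. smult (1 / D d) (\<Prod>b\<in>monics d - {a}. [:- \<phi> b, 1:]))
      = - pderiv (psi_poly d)"
  proof -
    have "smult c (sum f S) = (\<Sum>x\<in>S. smult c (f x))" for c and f :: "'a poly \<Rightarrow> 'k poly" and S
      by (induction S rule: infinite_finite_induct) (simp_all add: smult_add_right)
    then show ?thesis
      by (simp add: psi_poly_eq pderiv_minus pderiv_smult pderiv_prod pderiv_pCons)
  qed
  also have "fps_of_poly \<dots> = fps_const (1 / L d)"
    by (simp add: pderiv_psi_poly fps_of_poly_const)
  finally show ?thesis .
qed

lemma power_sum_1: "power_sum d 1 = 1 / L d"
  using fps_recursion(1)[OF q_ge_2 power_sum_generating[of d]] by simp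

text \<open>For i \<le> d every factor of G_i is a q^i-th power by Frobenius, and the bases multiply
  to L_d / L_(d-i). For i > d the factor with index i - d is zero.\<close>

lemma AT_G_conv_psi_coeff: "AT_G q \<theta> (\<theta> ^ (q ^ d)) i / D i = psi_coeff d i * L d ^ (q ^ i)"
proof (cases "i \<le> d")
  case True
  define n where "n = d - i"
  have d: "d = n + i" using True by (simp add: n_def)
  have "AT_G q \<theta> (\<theta> ^ (q ^ d)) i = (\<Prod>k=1..i. (\<theta> - \<theta> ^ (q ^ (n + k))) ^ (q ^ i))"
    unfolding AT_G_def d
    by (intro prod.cong refl) (simp add: frob_diff ac_simps flip: power_mult power_add)
  also have "\<dots> = (L d / L n) ^ (q ^ i)"
    using L_neq_0[of n] by (simp add: d carlitz_L_add prod_power_distrib)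
  finally show ?thesis
    using True by (simp add: psi_coeff_def n_def power_divide)
next
  case False
  have "\<theta> ^ (q ^ i) - (\<theta> ^ (q ^ d)) ^ (q ^ (i - d)) = 0"
    using False by (simp flip: power_mult power_add)
  moreover have "i - d \<in> {1..i}"
    using False by auto
  ultimately have "AT_G q \<theta> (\<theta> ^ (q ^ d)) i = 0"
    unfolding AT_G_def by (intro prod_zero) blast+
  then show ?thesis
    using False by (simp add: psi_coeff_def)
qed

text \<open>Substituting L_d x for x in the generating series of the power sums turns its recursion
  into that of the Anderson-Thakur series at y = \<theta>^(q^d). The additional factor L_d
  normalises the constant term to 1.\<close>

lemma AT_rec_power_sum:
  "AT_rec q \<theta> (\<theta> ^ (q ^ d)) n = carlitz_Pi q \<theta> n * (L d ^ Suc n * power_sum d (Suc n))"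
proof (rule AT_rec_eqI[OF q_ge_2 bracket_neq_0])
  show "L d ^ Suc 0 * power_sum d (Suc 0) = 1"
    using power_sum_1[of d] L_neq_0[of d] by simp
  show "L d ^ Suc n * power_sum d (Suc n) = (\<Sum>k=1..n. (\<Sum>i | q ^ i = k.
      AT_G q \<theta> (\<theta> ^ (q ^ d)) i / D i) * (L d ^ Suc (n - k) * power_sum d (Suc (n - k))))"
    if "n > 0" for n
  proof -
    have "L d ^ Suc n * ((\<Sum>i | q ^ i = k. psi_coeff d i) * power_sum d (Suc (n - k)))
        = (\<Sum>i | q ^ i = k. AT_G q \<theta> (\<theta> ^ (q ^ d)) i / D i) * (L d ^ Suc (n - k) * power_sum d (Suc (n - k)))"
      if k: "k \<in> {1..n}" for k
    proof -
      have "L d ^ Suc n = L d ^ k * L d ^ Suc (n - k)"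
        using k by (simp flip: power_add)
      moreover have "(\<Sum>i | q ^ i = k. AT_G q \<theta> (\<theta> ^ (q ^ d)) i / D i)
          = L d ^ k * (\<Sum>i | q ^ i = k. psi_coeff d i)"
        by (simp add: AT_G_conv_psi_coeff sum_distrib_left mult.commute)
      ultimately show ?thesis by (simp only: ac_simps)
    qed
    then have "L d ^ Suc n * (\<Sum>k=1..n. (\<Sum>i | q ^ i = k. psi_coeff d i) * power_sum d (Suc (n - k)))
        = (\<Sum>k=1..n. (\<Sum>i | q ^ i = k. AT_G q \<theta> (\<theta> ^ (q ^ d)) i / D i) * (L d ^ Suc (n - k) * power_sum d (Suc (n - k))))"
      by (simp only: sum_distrib_left[of "L d ^ Suc n"] cong: sum.cong)
    then show ?thesis
      using fps_recursion(2)[OF q_ge_2 power_sum_generating[of d] that] by simp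
  qed
qed

end

section \<open>Power series in the Carlitz exponential\<close>

text \<open>Only the terms of F up to degree n matter, and for this finite sum the Frobenius map is
  additive; the tail has order beyond n.\<close>

lemma fps_frob_nth:
  fixes F :: "'a::comm_ring_1 fps"
  assumes "prime CHAR('a)" and Q: "Q = CHAR('a) ^ e"
  shows "fps_nth (F ^ Q) n = (if Q dvd n then fps_nth F (n div Q) ^ Q else 0)"
proof -
  have prime: "prime CHAR('a fps)" and Q': "Q = CHAR('a fps) ^ e"
    using assms by simp_all
  have Q0: "Q > 0"
    using assms prime_gt_0_nat by simp
  define G where "G = (\<Sum>i=0..n. fps_const (fps_nth F i) * fps_X ^ i)"
  define R where "R = fps_shift (Suc n) (F - G)"
  have "F = G + fps_X ^ Suc n * R"
    by (rule fps_ext) (auto simp: R_def G_def fps_sum_rep_nth fps_X_power_mult_nth simp del: power_Suc)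
  then have "F ^ Q = (G + fps_X ^ Suc n * R) ^ Q"
    by (rule arg_cong)
  also have "\<dots> = G ^ Q + fps_X ^ (Suc n * Q) * R ^ Q"
    by (simp only: freshmans_dream'[OF prime Q'] power_mult_distrib power_mult)
  finally have "F ^ Q = G ^ Q + fps_X ^ (Suc n * Q) * R ^ Q" .
  moreover have "n < Suc n * Q"
    using Q0 by (cases Q) auto
  ultimately have "fps_nth (F ^ Q) n = fps_nth (G ^ Q) n"
    by (simp add: fps_X_power_mult_nth)
  also have "G ^ Q = (\<Sum>i=0..n. fps_const (fps_nth F i ^ Q) * fps_X ^ (i * Q))"
    unfolding G_def freshmans_dream_sum'[OF prime Q']
    by (simp add: power_mult_distrib fps_const_power power_mult)
  also have "fps_nth \<dots> n = (\<Sum>i=0..n. if i * Q = n then fps_nth F i ^ Q else 0)"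
    by (simp add: fps_sum_nth eq_commute if_distrib[of "(*) _"] cong: if_cong)
  also have "\<dots> = (if Q dvd n then fps_nth F (n div Q) ^ Q else 0)"
  proof (cases "Q dvd n")
    case True
    then obtain m where m: "n = m * Q" by (metis dvd_def mult.commute)
    then have "i * Q = n \<longleftrightarrow> i = m" for i using Q0 by simp
    moreover have "m \<le> n" using Q0 m by simp
    ultimately show ?thesis using m Q0 by simp
  next
    case False
    then have "i * Q \<noteq> n" for i by auto
    then show ?thesis using False by simp
  qed
  finally show ?thesis .
qed

lemma fps_nth_power_less:
  fixes F :: "'a::comm_ring_1 fps"
  assumes "fps_nth F 0 = 0" "n < k"
  shows "fps_nth (F ^ k) n = 0"
  using assms startsby_zero_power_prefix by blast

lemma fps_power_supported_multiples:
  fixes F :: "'a::comm_ring_1 fps"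
  assumes "\<And>n. \<not> q dvd n \<Longrightarrow> fps_nth F n = 0" "\<not> q dvd n"
  shows "fps_nth (F ^ k) n = 0"
  using assms(2)
proof (induction k arbitrary: n)
  case 0
  then show ?case by (cases "n = 0") auto
next
  case (Suc k)
  have "fps_nth F i * fps_nth (F ^ k) (n - i) = 0" if "i \<le> n" for i
  proof (cases "q dvd i")
    case True
    then have "\<not> q dvd n - i" using that Suc.prems by (metis dvd_add le_add_diff_inverse)
    then show ?thesis using Suc.IH by simp
  qed (simp add: assms(1))
  then show ?case by (simp add: fps_mult_nth)
qed

context carlitz_field
begin

abbreviation "E \<equiv> carlitz_exp q \<theta>"

lemma exp_nth_power: "fps_nth E (q ^ i) = 1 / D i"
proof -
  have "{j. q ^ j = q ^ i} = {i}" using q_ge_2 by auto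
  then show ?thesis by (simp add: carlitz_exp_def q_power_series_nth)
qed

lemma exp_nth_eq_0: "n \<notin> range (\<lambda>i. q ^ i) \<Longrightarrow> fps_nth E n = 0"
  by (auto simp: carlitz_exp_def q_power_series_nth intro!: sum.neutral)

lemma exp_nth_0: "fps_nth E 0 = 0"
  using q_ge_2 by (intro exp_nth_eq_0) auto

lemma exp_nth_1: "fps_nth E (Suc 0) = 1"
  using exp_nth_power[of 0] by simp

lemma exp_neq_0: "E \<noteq> 0"
  using exp_nth_1 by auto

lemma frob_nth:
  "fps_nth (F ^ (q ^ i)) n = (if q ^ i dvd n then fps_nth (F :: 'k fps) (n div q ^ i) ^ (q ^ i) else 0)"
proof -
  obtain e where "q ^ i = CHAR('k) ^ e" using q_power_char by blast
  then show ?thesis by (rule fps_frob_nth[OF prime_char])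
qed

text \<open>Write e_C = z + Y with Y a series in z^q. In the binomial expansion, z^k Y^(q-1-k) has
  only exponents congruent to k modulo q, so the residue q - 1 comes from z^(q-1) alone.\<close>

lemma exp_power_nth_residue:
  assumes "n mod q = q - 1"
  shows "fps_nth (E ^ (q - 1)) n = (if n = q - 1 then 1 else 0)"
proof -
  define Y where "Y = E - fps_X"
  have Y: "fps_nth Y m = 0" if "\<not> q dvd m" for m
  proof (cases "m = 1")
    case True
    then show ?thesis by (simp add: Y_def exp_nth_1)
  next
    case False
    have "m \<noteq> q ^ i" for i
      using False that by (cases i) auto
    then have "fps_nth E m = 0" by (intro exp_nth_eq_0) auto
    then show ?thesis using False by (simp add: Y_def)
  qed
  have lower: "fps_nth (of_nat c * fps_X ^ k * Y ^ (q - 1 - k)) n = 0" if k: "k < q - 1" for c k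
  proof -
    have "fps_nth (Y ^ (q - 1 - k)) (n - k) = 0" if "k \<le> n"
    proof (rule fps_power_supported_multiples[OF Y])
      have "n - k = q * (n div q) + (q - 1 - k)"
        using mult_div_mod_eq[of q n] assms k by linarith
      moreover have "\<not> q dvd q - 1 - k"
        using k by (intro nat_dvd_not_less) auto
      ultimately show "\<not> q dvd n - k"
        by (metis dvd_add_right_iff dvd_triv_left)
    qed
    then show ?thesis
      by (simp add: fps_X_power_mult_nth mult.assoc fps_of_nat fps_mult_left_const_nth flip: fps_of_nat)
  qed
  have "E ^ (q - 1) = (fps_X + Y) ^ (q - 1)"
    by (simp add: Y_def)
  also have "\<dots> = (\<Sum>k\<le>q - 1. of_nat ((q - 1) choose k) * fps_X ^ k * Y ^ (q - 1 - k))"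
    by (rule binomial_ring)
  also have "\<dots> = fps_X ^ (q - 1) + (\<Sum>k<q - 1. of_nat ((q - 1) choose k) * fps_X ^ k * Y ^ (q - 1 - k))"
    by (simp add: lessThan_Suc_atMost[symmetric])
  finally have "fps_nth (E ^ (q - 1)) n = fps_nth (fps_X ^ (q - 1)) n +
      (\<Sum>k<q - 1. fps_nth (of_nat ((q - 1) choose k) * fps_X ^ k * Y ^ (q - 1 - k)) n)"
    by (simp only: fps_add_nth fps_sum_nth)
  also have "(\<Sum>k<q - 1. fps_nth (of_nat ((q - 1) choose k) * fps_X ^ k * Y ^ (q - 1 - k)) n) = 0"
    using lower by (intro sum.neutral) blast
  finally show ?thesis by simp
qed

text \<open>Since q^(m+1) - 1 = q (q^m - 1) + (q - 1), the power is a q-th power, with exponents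
  divisible by q, times E^(q-1). The second factor must then supply the residue q - 1, which forces
  the exponent q - 1 itself and leaves the case of m and d - 1.\<close>

lemma exp_power_nth: "fps_nth (E ^ (q ^ m - 1)) (q ^ d - 1) = (if m = d then 1 else 0)"
proof (induction m arbitrary: d)
  case 0
  then show ?case using q_ge_2 by (auto simp: le_Suc_eq)
next
  case (Suc m)
  have qm: "q ^ m \<ge> 1" using q_ge_2 by simp
  show ?case
  proof (cases d)
    case 0
    have "q ^ Suc m > 1" using q_ge_2 by (intro one_less_power) auto
    then show ?thesis using 0 exp_nth_0 by (simp add: fps_nth_power_less del: power_Suc)
  next
    case d: (Suc d')
    have qd: "q ^ d' \<ge> 1" using q_ge_2 by simp
    let ?n = "q ^ Suc d' - 1"
    let ?B = "E ^ (q ^ m - 1)"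
    have B: "fps_nth (?B ^ q) j = (if q dvd j then fps_nth ?B (j div q) ^ q else 0)" for j
      using frob_nth[of ?B 1 j] by simp
    have n: "?n = q * (q ^ d' - 1) + (q - 1)"
    proof -
      obtain a where "q ^ d' = Suc a" using qd by (metis Suc_le_D One_nat_def)
      then show ?thesis using q_ge_2 by simp
    qed
    have "q ^ Suc m - 1 = (q - 1) + (q ^ m - 1) * q"
    proof -
      obtain a where "q ^ m = Suc a" using qm by (metis Suc_le_D One_nat_def)
      then show ?thesis using q_ge_2 by (simp add: mult.commute)
    qed
    then have "E ^ (q ^ Suc m - 1) = ?B ^ q * E ^ (q - 1)"
      by (simp only: power_add power_mult) (rule mult.commute)
    then have "fps_nth (E ^ (q ^ Suc m - 1)) ?n = (\<Sum>j=0..?n. fps_nth (?B ^ q) j * fps_nth (E ^ (q - 1)) (?n - j))"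
      by (simp only: fps_mult_nth)
    also have "\<dots> = (\<Sum>j\<in>{q * (q ^ d' - 1)}. fps_nth (?B ^ q) j * fps_nth (E ^ (q - 1)) (?n - j))"
    proof (rule sum.mono_neutral_right)
      show "{q * (q ^ d' - 1)} \<subseteq> {0..?n}" using n by simp
      show "\<forall>j\<in>{0..?n} - {q * (q ^ d' - 1)}. fps_nth (?B ^ q) j * fps_nth (E ^ (q - 1)) (?n - j) = 0"
      proof
        fix j assume j: "j \<in> {0..?n} - {q * (q ^ d' - 1)}"
        show "fps_nth (?B ^ q) j * fps_nth (E ^ (q - 1)) (?n - j) = 0"
        proof (cases "q dvd j")
          case True
          then obtain k where k: "j = q * k" by blast
          have "q * k \<le> ?n" using j by (simp only: k[symmetric]) auto
          also have "?n < q * q ^ d'" using q_ge_2 by simp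
          finally have "k < q ^ d'" by simp
          then have "k \<le> q ^ d' - 1" by linarith
          then obtain c where c: "q ^ d' - 1 = k + c" by (metis le_iff_add)
          have "?n - j = q * c + (q - 1)"
            by (simp only: n c k distrib_left)
          then have "(?n - j) mod q = q - 1"
            using q_ge_2 by (simp only: mod_mult_self4) simp
          moreover have "?n - j \<noteq> q - 1"
            using j n by auto
          ultimately have "fps_nth (E ^ (q - 1)) (?n - j) = 0"
            by (simp only: exp_power_nth_residue if_False)
          then show ?thesis by (simp only: mult_zero_right)
        qed (simp only: B if_False mult_zero_left)
      qed
    qed simp
    also have "\<dots> = fps_nth ?B (q ^ d' - 1) ^ q"
    proof -
      have "q - 1 = ?n - q * (q ^ d' - 1)" using n by simp
      moreover have "fps_nth (E ^ (q - 1)) (q - 1) = 1"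
        using q_ge_2 exp_power_nth_residue[of "q - 1"] by simp
      moreover have "fps_nth (?B ^ q) (q * (q ^ d' - 1)) = fps_nth ?B (q ^ d' - 1) ^ q"
        using q_ge_2 by (simp add: B del: One_nat_def)
      ultimately show ?thesis
        by (simp only: sum.insert sum.empty finite.emptyI empty_iff not_False_eq_True) simp
    qed
    also have "\<dots> = (if Suc m = d then 1 else 0)"
      using q_ge_2 by (simp add: Suc.IH d del: One_nat_def)
    finally show ?thesis by (simp only: d)
  qed
qed

text \<open>The infinite sum of t_i E^(q^i - 1). Cutting it at i \<le> n is exact for the n-th
  coefficient, because the i-th term has order at least q^i - 1 \<ge> i.\<close>

definition exp_series :: "(nat \<Rightarrow> 'k) \<Rightarrow> 'k fps" where
  "exp_series t = Abs_fps (\<lambda>n. \<Sum>i\<le>n. t i * fps_nth (E ^ (q ^ i - 1)) n)"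

lemma less_power_minus_1: "i \<le> q ^ i - 1"
  using less_power_self[OF q_ge_2, of i] by linarith

lemma exp_series_nth: "fps_nth (exp_series t) (q ^ d - 1) = t d"
proof -
  have "(\<Sum>i\<le>q ^ d - 1. t i * (if i = d then 1 else 0)) = (\<Sum>i\<in>{d}. t i * (if i = d then 1 else 0))"
    using less_power_minus_1[of d] by (intro sum.mono_neutral_right) auto
  then show ?thesis
    by (simp add: exp_series_def exp_power_nth del: One_nat_def)
qed

lemma exp_times_exp_series_nth:
  "fps_nth (E * exp_series t) n = (\<Sum>i\<le>n. t i * fps_nth (E ^ (q ^ i)) n)"
proof -
  have "fps_nth (exp_series t) m = (\<Sum>i\<le>n. t i * fps_nth (E ^ (q ^ i - 1)) m)" if "m \<le> n" for m
  proof -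
    have "fps_nth (E ^ (q ^ i - 1)) m = 0" if "i > m" for i
      using that less_power_minus_1[of i] by (intro fps_nth_power_less exp_nth_0) auto
    then show ?thesis
      using that unfolding exp_series_def fps_nth_Abs_fps by (intro sum.mono_neutral_left) auto
  qed
  then have "fps_nth (E * exp_series t) n
      = (\<Sum>k=0..n. fps_nth E k * (\<Sum>i\<le>n. t i * fps_nth (E ^ (q ^ i - 1)) (n - k)))"
    by (simp add: fps_mult_nth)
  also have "\<dots> = (\<Sum>i\<le>n. t i * (\<Sum>k=0..n. fps_nth E k * fps_nth (E ^ (q ^ i - 1)) (n - k)))"
    unfolding sum_distrib_left by (subst sum.swap) (simp add: ac_simps)
  also have "\<dots> = (\<Sum>i\<le>n. t i * fps_nth (E * E ^ (q ^ i - 1)) n)"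
    by (simp only: fps_mult_nth)
  also have "\<dots> = (\<Sum>i\<le>n. t i * fps_nth (E ^ (q ^ i)) n)"
  proof -
    have "E * E ^ (q ^ i - 1) = E ^ (q ^ i)" for i
      using q_ge_2 by (simp flip: power_Suc)
    then show ?thesis by simp
  qed
  finally show ?thesis .
qed

lemma exp_power_nth_power:
  "fps_nth (E ^ (q ^ i)) (q ^ m) = (if i \<le> m then 1 / D (m - i) ^ (q ^ i) else 0)"
proof (cases "i \<le> m")
  case True
  then have "q ^ i dvd q ^ m" "q ^ m div q ^ i = q ^ (m - i)"
    using q_ge_2 by (simp_all add: le_imp_power_dvd power_diff)
  then show ?thesis using True by (simp add: frob_nth exp_nth_power power_divide)
next
  case False
  then have "q ^ m < q ^ i" using q_ge_2 by (intro power_strict_increasing) auto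
  then show ?thesis using False by (simp add: fps_nth_power_less exp_nth_0)
qed

text \<open>The left side is the sum of E^(q^i) / L_i. It involves only exponents that are powers of
  q, and there \<open>log_exp_coeff\<close> applies.\<close>

lemma exp_log: "E * exp_series (\<lambda>i. 1 / L i) = fps_X"
proof (rule fps_ext)
  fix n
  show "fps_nth (E * exp_series (\<lambda>i. 1 / L i)) n = fps_nth fps_X n"
  proof (cases "n \<in> range (\<lambda>i. q ^ i)")
    case True
    then obtain m where m: "n = q ^ m" by blast
    have "m \<le> n" using less_power_self[OF q_ge_2, of m] m by simp
    then have "(\<Sum>i\<le>n. 1 / L i * fps_nth (E ^ (q ^ i)) n) = (\<Sum>i\<le>m. 1 / L i * fps_nth (E ^ (q ^ i)) n)"
      using m by (intro sum.mono_neutral_right) (auto simp: exp_power_nth_power)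
    also have "\<dots> = (if m = 0 then 1 else 0)"
      unfolding m log_exp_coeff[symmetric]
      by (intro sum.cong refl) (simp add: exp_power_nth_power)
    finally show ?thesis
      using m q_ge_2 by (simp add: exp_times_exp_series_nth)
  next
    case False
    have "fps_nth (E ^ (q ^ i)) n = 0" for i
    proof (cases "q ^ i dvd n")
      case True
      then obtain k where k: "n = q ^ i * k" by blast
      have "k \<notin> range (\<lambda>i. q ^ i)"
      proof
        assume "k \<in> range (\<lambda>i. q ^ i)"
        then obtain l where "n = q ^ (i + l)" using k by (auto simp: power_add)
        then show False using False by blast
      qed
      then show ?thesis
        using True k q_ge_2 by (simp add: frob_nth exp_nth_eq_0 zero_power)
    qed (simp add: frob_nth)
    moreover have "n \<noteq> 1" using False by (metis power_0 rangeI)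
    ultimately show ?thesis by (simp add: exp_times_exp_series_nth)
  qed
qed

text \<open>So L_d BC_(q^d-1) = \<Pi>(q^d - 1) is nonzero, and dividing by it in the theorem reduces
  the generalised number to a bare power series coefficient.\<close>

lemma bernoulli_carlitz_eq: "bernoulli_carlitz q \<theta> (q ^ d - 1) = carlitz_Pi q \<theta> (q ^ d - 1) / L d"
proof -
  have "fps_X / E = exp_series (\<lambda>i. 1 / L i)"
    by (subst exp_log[symmetric]) (simp add: exp_neq_0)
  then show ?thesis
    by (simp add: bernoulli_carlitz_def exp_series_nth del: One_nat_def)
qed

definition polylog_coeff :: "nat list \<Rightarrow> (nat \<Rightarrow> 'k) \<Rightarrow> nat list \<Rightarrow> 'k" where
  "polylog_coeff s c is = (\<Prod>k<length s. c k ^ (q ^ (is ! k)) / L (is ! k) ^ (s ! k))"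

end

section \<open>Convergence and closed form of the polylogarithm\<close>

definition decreasing :: "nat \<Rightarrow> nat list set" where
  "decreasing r = {is. length is = r \<and> sorted_wrt (>) is}"

lemma finite_decreasing:
  assumes "r > 0"
  shows "finite {is \<in> decreasing r. hd is \<le> n}"
proof (rule finite_subset)
  have "set is \<subseteq> {..n}" if "is \<in> decreasing r" "hd is \<le> n" for "is"
    using assms that by (cases "is") (auto simp: decreasing_def)
  then show "{is \<in> decreasing r. hd is \<le> n} \<subseteq> {is. set is \<subseteq> {..n} \<and> length is = r}"
    by (auto simp: decreasing_def)
  show "finite {is. set is \<subseteq> {..n} \<and> length is = r}"
    by (rule finite_lists_length_eq) simp
qed

text \<open>Here \<open>w i\<close> bounds the order of the i-th term from below. Finitely many
  terms have weight at most n, so each coefficient is eventually constant along the finite partial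
  sums.\<close>

lemma fps_has_sum:
  fixes t :: "'i \<Rightarrow> 'a::comm_ring_1 fps"
  assumes fin: "\<And>n. finite {i \<in> I. w i \<le> n}"
    and zero: "\<And>i n. i \<in> I \<Longrightarrow> n < w i \<Longrightarrow> fps_nth (t i) n = 0"
  shows "(t has_sum Abs_fps (\<lambda>n. \<Sum>i | i \<in> I \<and> w i \<le> n. fps_nth (t i) n)) I"
proof -
  let ?F = "Abs_fps (\<lambda>n. \<Sum>i | i \<in> I \<and> w i \<le> n. fps_nth (t i) n)"
  have "\<exists>X. finite X \<and> X \<subseteq> I \<and> (\<forall>Y. finite Y \<and> X \<subseteq> Y \<and> Y \<subseteq> I \<longrightarrow> dist (sum t Y) ?F < e)"
    if "e > 0" for e
  proof -
    \<comment> \<open>The distance of two distinct series is 2 to the minus order of their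
      difference, so agreement of all coefficients up to N is enough.\<close>
    obtain N :: nat where N: "inverse (2 ^ N) < e"
      using reals_power_lt_ex[of e 2] \<open>e > 0\<close> by (auto simp: power_one_over inverse_eq_divide)
    have "dist (sum t Y) ?F < e"
      if Y: "finite Y" "{i \<in> I. w i \<le> N} \<subseteq> Y" "Y \<subseteq> I" for Y
    proof (cases "sum t Y = ?F")
      case False
      have "fps_nth (sum t Y) n = fps_nth ?F n" if "n \<le> N" for n
      proof -
        have "fps_nth (sum t Y) n = (\<Sum>i\<in>Y. fps_nth (t i) n)"
          by (rule fps_sum_nth)
        also have "\<dots> = (\<Sum>i | i \<in> I \<and> w i \<le> n. fps_nth (t i) n)"
          using Y that zero by (intro sum.mono_neutral_right) (auto, metis not_le subsetD)
        finally show ?thesis by simp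
      qed
      then have "subdegree (sum t Y - ?F) > N"
        using False by (intro subdegree_greaterI) auto
      then have "inverse (2 ^ subdegree (sum t Y - ?F)) \<le> (inverse (2 ^ N) :: real)"
        by (intro le_imp_inverse_le power_increasing) auto
      then have "inverse (2 ^ subdegree (sum t Y - ?F)) < e" using N by (rule le_less_trans)
      then show ?thesis using False by (simp add: dist_fps_def)
    qed (use \<open>e > 0\<close> in simp)
    then show ?thesis
      using fin[of N] by (intro exI[of _ "{i \<in> I. w i \<le> N}"]) auto
  qed
  then show ?thesis
    unfolding has_sum_def tendsto_iff eventually_finite_subsets_at_top by blast
qed

context carlitz_field
begin

text \<open>Only the first argument contains z, so each term is a constant times E^(q^(i_1)).
  Grouping by the head i_1 of the index list gives a series in these powers, and one factor E splits
  off.\<close>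

lemma carlitz_polylog_eq:
  assumes s: "s \<noteq> []" and zs: "zs ! 0 = E * fps_const (c 0)"
    "\<And>k. 0 < k \<Longrightarrow> k < length s \<Longrightarrow> zs ! k = fps_const (c k)"
  shows "carlitz_polylog q \<theta> s zs
    = E * exp_series (\<lambda>d. \<Sum>is | is \<in> decreasing (length s) \<and> hd is = d. polylog_coeff s c is)"
proof -
  let ?I = "decreasing (length s)"
  have len: "length s > 0" using s by simp
  define t where "t is = fps_const (polylog_coeff s c is) * E ^ (q ^ hd is)" for "is"
  have t: "(\<Prod>k<length s. (zs ! k) ^ (q ^ (is ! k)) * fps_const (1 / L (is ! k) ^ (s ! k))) = t is"
    if "is \<in> ?I" for "is"
  proof -
    have "is \<noteq> []" using that len by (auto simp: decreasing_def)
    then have hd: "hd is = is ! 0" by (rule hd_conv_nth)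
    have "(zs ! k) ^ (q ^ (is ! k)) * fps_const (1 / L (is ! k) ^ (s ! k)) =
        (if k = 0 then E ^ (q ^ hd is) else 1) * fps_const (c k ^ (q ^ (is ! k)) / L (is ! k) ^ (s ! k))"
      if "k < length s" for k
      using that zs(1) zs(2)[of k]
      by (cases "k = 0") (auto simp: hd power_mult_distrib fps_const_power mult.assoc)
    then have "(\<Prod>k<length s. (zs ! k) ^ (q ^ (is ! k)) * fps_const (1 / L (is ! k) ^ (s ! k)))
        = (\<Prod>k<length s. if k = 0 then E ^ (q ^ hd is) else 1) *
          (\<Prod>k<length s. fps_const (c k ^ (q ^ (is ! k)) / L (is ! k) ^ (s ! k)))"
      unfolding prod.distrib[symmetric] by (intro prod.cong refl) simp
    moreover have "(\<Prod>k<n. fps_const (f k)) = fps_const (\<Prod>k<n. f k)" for n and f :: "nat \<Rightarrow> 'k"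
      by (induction n) auto
    ultimately show ?thesis
      using len by (simp add: t_def polylog_coeff_def prod.delta)
  qed
  have zero: "fps_nth (t is) n = 0" if "n < hd is" for "is" n
    using that less_power_self[OF q_ge_2, of "hd is"]
    by (simp add: t_def fps_nth_power_less exp_nth_0)
  have "carlitz_polylog q \<theta> s zs = infsum t ?I"
    unfolding carlitz_polylog_def decreasing_def[symmetric] by (rule infsum_cong) (rule t)
  also have "\<dots> = Abs_fps (\<lambda>n. \<Sum>is | is \<in> ?I \<and> hd is \<le> n. fps_nth (t is) n)"
    by (intro infsumI fps_has_sum finite_decreasing len zero)
  also have "\<dots> = E * exp_series (\<lambda>d. \<Sum>is | is \<in> ?I \<and> hd is = d. polylog_coeff s c is)"
  proof (rule fps_ext)
    fix n
    have "(\<Sum>is | is \<in> ?I \<and> hd is \<le> n. fps_nth (t is) n)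
        = (\<Sum>d\<le>n. \<Sum>is | is \<in> {is \<in> ?I. hd is \<le> n} \<and> hd is = d. fps_nth (t is) n)"
      by (rule sum.group[symmetric]) (auto intro: finite_decreasing[OF len])
    also have "\<dots> = (\<Sum>d\<le>n. (\<Sum>is | is \<in> ?I \<and> hd is = d. polylog_coeff s c is) * fps_nth (E ^ (q ^ d)) n)"
      unfolding sum_distrib_right by (intro sum.cong refl) (auto simp: t_def)
    finally show "fps_nth (Abs_fps (\<lambda>n. \<Sum>is | is \<in> ?I \<and> hd is \<le> n. fps_nth (t is) n)) n
        = fps_nth (E * exp_series (\<lambda>d. \<Sum>is | is \<in> ?I \<and> hd is = d. polylog_coeff s c is)) n"
      by (simp add: exp_times_exp_series_nth)
  qed
  finally show ?thesis .
qed

end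

section \<open>Sums over lists\<close>

lemma listset_iff: "xs \<in> listset As \<longleftrightarrow> length xs = length As \<and> (\<forall>i<length As. xs ! i \<in> As ! i)"
proof (induction As arbitrary: xs)
  case (Cons A As)
  then show ?case
    by (cases xs) (auto simp: set_Cons_def nth_Cons less_Suc_eq_0_disj split: nat.splits)
qed auto

lemma listset_Cons: "listset (A # As) = (\<lambda>(x, xs). x # xs) ` (A \<times> listset As)"
  by (auto simp: set_Cons_def)

text \<open>The distributive law for a product of sums; it is used for the tuples j and again for
  tuples of monic polynomials of prescribed degrees.\<close>

lemma prod_sum_listset:
  fixes f :: "nat \<Rightarrow> 'a \<Rightarrow> 'b::comm_semiring_1"
  shows "(\<Prod>i<length As. \<Sum>x\<in>As ! i. f i x) = (\<Sum>xs\<in>listset As. \<Prod>i<length As. f i (xs ! i))"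
proof (induction As arbitrary: f)
  case (Cons A As)
  have "inj_on (\<lambda>(x, xs). x # xs) (A \<times> listset As)"
    by (auto simp: inj_on_def)
  then have "(\<Sum>xs\<in>listset (A # As). \<Prod>i<length (A # As). f i (xs ! i))
      = (\<Sum>(x, xs)\<in>A \<times> listset As. f 0 x * (\<Prod>i<length As. f (Suc i) (xs ! i)))"
    unfolding listset_Cons
    by (subst sum.reindex) (auto intro!: sum.cong simp: prod.lessThan_Suc_shift simp del: prod.lessThan_Suc)
  also have "\<dots> = (\<Sum>x\<in>A. f 0 x) * (\<Sum>xs\<in>listset As. \<Prod>i<length As. f (Suc i) (xs ! i))"
    by (simp add: sum_product sum.cartesian_product)
  also have "\<dots> = (\<Prod>i<length (A # As). \<Sum>x\<in>(A # As) ! i. f i x)"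
    by (simp add: Cons.IH[of "\<lambda>i. f (Suc i)", symmetric] prod.lessThan_Suc_shift del: prod.lessThan_Suc)
  finally show ?case by (rule sym)
qed simp

text \<open>This is the origin of the lower limit r - 1: below d there must be room for r - 1
  further indices.\<close>

lemma decreasing_length_le:
  assumes "sorted_wrt (>) (d # js :: nat list)"
  shows "length js \<le> d"
  using assms
proof (induction js arbitrary: d)
  case (Cons j js)
  then have "length js \<le> j" "j < d" by auto
  then show ?case by simp
qed simp

lemma finite_decreasing_below: "finite {is. length is = n \<and> sorted_wrt (>) ((N::nat) # is)}"
proof (rule finite_subset)
  show "{is. length is = n \<and> sorted_wrt (>) (N # is)} \<subseteq> {is. set is \<subseteq> {..<N} \<and> length is = n}"
    by auto
qed (rule finite_lists_length_eq, simp)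

text \<open>
  Splitting a decreasing list of length \<open>r' + r\<close> at position \<open>r'\<close>, the entry there being shared
  by the two parts.
\<close>

lemma sum_decreasing_split:
  assumes r: "r \<ge> 1"
  shows "(\<Sum>ks | length ks = r' + r \<and> sorted_wrt (>) (N # ks). g (take r' ks) (drop r' ks))
    = (\<Sum>ds | length ds = r' + 1 \<and> sorted_wrt (>) (N # ds) \<and> last ds \<ge> r - 1.
        \<Sum>is | is \<in> decreasing r \<and> hd is = last ds. g (butlast ds) is)"
    (is "sum _ ?K = (\<Sum>ds\<in>?D. sum _ (?I ds))")
proof -
  have fin: "finite ?D"
    by (rule finite_subset[OF _ finite_decreasing_below[of "r' + 1" N]]) auto
  have finI: "finite (?I ds)" for ds
    by (rule finite_subset[OF _ finite_decreasing[of r "last ds"]]) (use r in auto)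
  have "(\<Sum>ds\<in>?D. \<Sum>is\<in>?I ds. g (butlast ds) is) = (\<Sum>(ds, is)\<in>Sigma ?D ?I. g (butlast ds) is)"
    using fin finI by (intro sum.Sigma) auto
  also have "\<dots> = (\<Sum>ks\<in>?K. g (take r' ks) (drop r' ks))"
  proof (rule sum.reindex_bij_witness[where i = "\<lambda>ks. (take (Suc r') ks, drop r' ks)" and j = "\<lambda>(ds, is). butlast ds @ is"])
    fix x assume "x \<in> Sigma ?D ?I"
    then obtain ds "is" where x: "x = (ds, is)" "ds \<in> ?D" "is \<in> ?I ds" by auto
    obtain u d where ds: "ds = u @ [d]" "length u = r'"
      using x(2) by (cases ds rule: rev_cases) auto
    obtain js where js: "is = d # js" "length js = r - 1"
      using x(3) ds r by (cases "is") (auto simp: decreasing_def)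
    show "(case x of (ds, is) \<Rightarrow> butlast ds @ is) \<in> ?K"
      using x ds js r by (auto simp: sorted_wrt_append decreasing_def, meson less_trans)
    show "(\<lambda>ks. (take (Suc r') ks, drop r' ks)) (case x of (ds, is) \<Rightarrow> butlast ds @ is) = x"
      using x ds js by simp
    show "g (take r' (case x of (ds, is) \<Rightarrow> butlast ds @ is)) (drop r' (case x of (ds, is) \<Rightarrow> butlast ds @ is))
        = (case x of (ds, is) \<Rightarrow> g (butlast ds) is)"
      using x ds js by simp
  next
    fix ks assume ks: "ks \<in> ?K"
    define u where "u = take r' ks"
    obtain d js where djs: "drop r' ks = d # js"
      using ks r by (cases "drop r' ks") auto
    have eq: "ks = u @ d # js"
      using djs by (metis append_take_drop_id u_def)
    have len: "length u = r'" "length js = r - 1"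
      using ks r djs by (auto simp: u_def) (metis One_nat_def diff_Suc_1 diff_add_inverse length_Cons length_drop)
    have sorted: "sorted_wrt (>) (N # u @ d # js)"
      using ks eq by simp
    then have "sorted_wrt (>) (d # js)"
      by (simp add: sorted_wrt_append)
    then have "r - 1 \<le> d"
      using decreasing_length_le len by metis
    then show "(take (Suc r') ks, drop r' ks) \<in> Sigma ?D ?I"
      using sorted len r by (auto simp: eq sorted_wrt_append decreasing_def)
    show "(case (take (Suc r') ks, drop r' ks) of (ds, is) \<Rightarrow> butlast ds @ is) = ks"
      using len by (simp add: eq)
  qed
  finally show ?thesis by (rule sym)
qed

context carlitz_embedding
begin

lemma finite_monic_lists:
  "finite {as :: 'a poly list. length as = n \<and> (\<forall>a\<in>set as. lead_coeff a = 1) \<and> sorted_wrt (>) (N # map degree as)}"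
proof (rule finite_subset)
  show "{as. length as = n \<and> (\<forall>a\<in>set as. lead_coeff a = 1) \<and> sorted_wrt (>) (N # map degree as)}
      \<subseteq> {as. set as \<subseteq> (\<Union>d<N. monics d) \<and> length as = n}"
    by (auto simp: monics_def)
  show "finite {as. set as \<subseteq> (\<Union>d<N. monics d :: 'a poly set) \<and> length as = n}"
    by (rule finite_lists_length_eq) (auto intro: finite_monics)
qed

text \<open>Group the lists by their degrees. The lists with given degrees form a full product of
  sets \<open>monics\<close>, over which the sum factors into power sums.\<close>

lemma sum_monic_lists:
  assumes n: "n = length s"
  shows "(\<Sum>as | length as = n \<and> (\<forall>a\<in>set as. lead_coeff a = 1) \<and> sorted_wrt (>) (N # map degree as).
        \<Prod>i<n. e i ^ degree (as ! i) * (1 / \<phi> (as ! i)) ^ (s ! i))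
    = (\<Sum>ks | length ks = n \<and> sorted_wrt (>) (N # ks). \<Prod>i<n. e i ^ (ks ! i) * power_sum (ks ! i) (s ! i))"
    (is "sum ?g ?S = sum ?h ?T")
proof -
  have fin: "finite ?S" "finite ?T"
    by (rule finite_monic_lists, rule finite_decreasing_below)
  have sub: "map degree ` ?S \<subseteq> ?T"
    by (rule image_subsetI) simp
  have "sum ?g ?S = (\<Sum>ks\<in>?T. \<Sum>as | as \<in> ?S \<and> map degree as = ks. ?g as)"
    using sum.group[OF fin sub, of ?g] by (rule sym)
  also have "\<dots> = sum ?h ?T"
  proof (rule sum.cong[OF refl])
    fix ks assume ks: "ks \<in> ?T"
    have "as \<in> ?S \<and> map degree as = ks \<longleftrightarrow> as \<in> listset (map monics ks)" for as
    proof
      assume "as \<in> ?S \<and> map degree as = ks"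
      then show "as \<in> listset (map monics ks)"
        by (auto simp: listset_iff monics_def)
    next
      assume as: "as \<in> listset (map monics ks)"
      then have deg: "map degree as = ks"
        by (intro nth_equalityI) (auto simp: listset_iff monics_def)
      moreover have "\<forall>a\<in>set as. lead_coeff a = 1"
        using as by (auto simp: listset_iff monics_def in_set_conv_nth)
      ultimately show "as \<in> ?S \<and> map degree as = ks"
        using ks by auto
    qed
    then have "(\<Sum>as | as \<in> ?S \<and> map degree as = ks. ?g as) = (\<Sum>as\<in>listset (map monics ks). ?g as)"
      by (simp only: Collect_mem_eq)
    also have "\<dots> = (\<Sum>as\<in>listset (map monics ks). \<Prod>i<n. e i ^ (ks ! i) * (1 / \<phi> (as ! i)) ^ (s ! i))"
      using ks by (intro sum.cong prod.cong refl) (auto simp: listset_iff monics_def)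
    also have "\<dots> = (\<Prod>i<n. \<Sum>a\<in>monics (ks ! i). e i ^ (ks ! i) * (1 / \<phi> a) ^ (s ! i))"
      using ks prod_sum_listset[of "\<lambda>i a. e i ^ (ks ! i) * (1 / \<phi> a) ^ (s ! i)" "map monics ks"]
      by simp
    also have "\<dots> = ?h ks"
      by (simp add: power_sum_def sum_distrib_left power_one_over)
    finally show "(\<Sum>as | as \<in> ?S \<and> map degree as = ks. ?g as) = ?h ks" .
  qed
  finally show ?thesis .
qed

text \<open>The map sending p to \<phi>(p)^(q^d) is a ring homomorphism by Frobenius. Applying it to
  the coefficients of H and then evaluating at \<theta> sends t to \<theta> and y to \<theta>^(q^d),
  the point treated in \<open>AT_rec_power_sum\<close>.\<close>

lemma AT_poly_power_sum:
  assumes n: "n \<ge> 1"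
  shows "(\<Sum>j\<le>degree (AT_poly q (n - 1) :: 'a poly poly). \<theta> ^ j * \<phi> (AT_coeff q n j) ^ (q ^ d))
    = carlitz_Gamma q \<theta> n * L d ^ n * power_sum d n"
proof -
  let ?f = "\<lambda>p. \<phi> p ^ (q ^ d)"
  interpret f: comm_ring_map ?f
    using q_ge_2 by unfold_locales (simp_all add: map_one map_add map_mult frob_add power_mult_distrib)
  interpret g: comm_ring_map "\<lambda>h. poly (map_poly ?f h) \<theta>"
    by (rule comm_ring_map_comp[OF f.map_poly_map comm_ring_map_poly])
  let ?H = "AT_poly q (n - 1) :: 'a poly poly"
  have "(\<Sum>j\<le>degree ?H. \<theta> ^ j * ?f (AT_coeff q n j)) = (\<Sum>j\<le>degree ?H. coeff (map_poly ?f ?H) j * \<theta> ^ j)"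
    by (simp add: AT_coeff_def coeff_map_poly f.map_zero mult.commute)
  also have "\<dots> = poly (map_poly ?f ?H) \<theta>"
  proof -
    have "coeff (map_poly ?f ?H) j = 0" if "j > degree (map_poly ?f ?H)" for j
      using that by (rule coeff_eq_0)
    then show ?thesis
      unfolding poly_altdef by (intro sum.mono_neutral_right) (auto simp: not_le map_poly_degree_leq f.map_zero)
  qed
  also have "\<dots> = AT_rec q \<theta> (\<theta> ^ (q ^ d)) (n - 1)"
    unfolding AT_poly_eq_AT_rec[OF q_ge_2] g.map_AT_rec
    by (simp add: map_poly_pCons f.map_zero f.map_one map_X)
  also have "\<dots> = carlitz_Gamma q \<theta> n * L d ^ n * power_sum d n"
    using n by (simp add: AT_rec_power_sum carlitz_Gamma_def)
  finally show ?thesis .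
qed

end

section \<open>Multiple zeta values in terms of Bernoulli--Carlitz numbers\<close>

lemma prod_lessThan_add:
  fixes f :: "nat \<Rightarrow> 'a::comm_monoid_mult"
  shows "(\<Prod>i<a + b. f i) = (\<Prod>i<a. f i) * (\<Prod>i<b. f (a + i))"
  by (induction b) (simp_all add: mult.assoc)

lemma AT_indices_eq:
  "AT_indices TYPE('a::field) q s = listset (map (\<lambda>n. {..degree (AT_poly q (n - 1) :: 'a poly poly)}) s)"
  by (auto simp: AT_indices_def listset_iff)

context carlitz_embedding
begin

text \<open>From \<gamma>^q = \<gamma> \<epsilon> and \<epsilon>^q = \<epsilon>. It produces the
  twist \<epsilon>^d and leaves one factor \<gamma>, which explains the normalising
  denominator.\<close>

lemma root_power:
  assumes "g ^ (q - 1) = \<phi> [:c:]"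
  shows "g ^ (q ^ d) = g * \<phi> [:c:] ^ d"
proof (induction d)
  case (Suc d)
  have "g ^ (q ^ Suc d) = (g ^ (q ^ d)) ^ q"
    by (simp add: mult.commute flip: power_mult)
  also have "\<dots> = g ^ q * (\<phi> [:c:] ^ q) ^ d"
    by (simp add: Suc.IH power_mult_distrib mult.commute flip: power_mult)
  also have "g ^ q = g * g ^ (q - 1)"
    using q_ge_2 by (simp flip: power_Suc)
  finally show ?case
    by (simp only: assms map_const_power power_Suc mult.assoc)
qed simp

definition zeta_term :: "nat list \<Rightarrow> 'a list \<Rightarrow> nat list \<Rightarrow> 'k" where
  "zeta_term s \<epsilon> is = (\<Prod>k<length s. \<phi> [:\<epsilon> ! k:] ^ (is ! k) * power_sum (is ! k) (s ! k))"

abbreviation AT_value :: "nat list \<Rightarrow> (nat \<Rightarrow> 'k) \<Rightarrow> nat list \<Rightarrow> nat \<Rightarrow> 'k" where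
  "AT_value s g js k \<equiv> g k * \<phi> (AT_coeff q (s ! k) (js ! k))"

text \<open>The sum over j factors by position. Each factor is an Anderson-Thakur evaluation whose
  power of L cancels the denominator of the polylogarithm.\<close>

lemma sum_polylog_coeff:
  assumes s: "\<And>k. k < length s \<Longrightarrow> s ! k \<ge> 1"
    and g: "\<And>k. k < length s \<Longrightarrow> g k ^ (q - 1) = \<phi> [:\<epsilon> ! k:]"
  shows "(\<Sum>js\<in>AT_indices TYPE('a) q s. \<theta> ^ sum_list js * polylog_coeff s (AT_value s g js) is)
    = (\<Prod>k<length s. g k * carlitz_Gamma q \<theta> (s ! k)) * zeta_term s \<epsilon> is"
proof -
  let ?J = "\<lambda>n. {..degree (AT_poly q (n - 1) :: 'a poly poly)}"
  let ?f = "\<lambda>k j. \<theta> ^ j * ((g k * \<phi> (AT_coeff q (s ! k) j)) ^ (q ^ (is ! k)) / L (is ! k) ^ (s ! k))"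
  have "\<theta> ^ sum_list js * polylog_coeff s (AT_value s g js) is = (\<Prod>k<length s. ?f k (js ! k))"
    if "js \<in> AT_indices TYPE('a) q s" for js
  proof -
    have "length js = length s" using that by (simp add: AT_indices_def)
    then have "\<theta> ^ sum_list js = (\<Prod>k<length s. \<theta> ^ (js ! k))"
      by (simp add: sum_list_sum_nth atLeast0LessThan Groups_Big.power_sum)
    then show ?thesis
      unfolding polylog_coeff_def prod.distrib by (rule arg_cong)
  qed
  then have "(\<Sum>js\<in>AT_indices TYPE('a) q s. \<theta> ^ sum_list js * polylog_coeff s (AT_value s g js) is)
      = (\<Sum>js\<in>listset (map ?J s). \<Prod>k<length s. ?f k (js ! k))"
    by (simp add: AT_indices_eq)
  also have "\<dots> = (\<Prod>k<length s. \<Sum>j\<in>?J (s ! k). ?f k j)"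
    using prod_sum_listset[of ?f "map ?J s"] by simp
  also have "\<dots> = (\<Prod>k<length s. (g k * carlitz_Gamma q \<theta> (s ! k)) *
      (\<phi> [:\<epsilon> ! k:] ^ (is ! k) * power_sum (is ! k) (s ! k)))"
  proof (rule prod.cong[OF refl])
    fix k assume "k \<in> {..<length s}"
    then have k: "k < length s" by simp
    have "(\<Sum>j\<in>?J (s ! k). ?f k j) = g k ^ (q ^ (is ! k)) / L (is ! k) ^ (s ! k) *
        (\<Sum>j\<in>?J (s ! k). \<theta> ^ j * \<phi> (AT_coeff q (s ! k) j) ^ (q ^ (is ! k)))"
      by (simp add: sum_distrib_left power_mult_distrib mult_ac)
    also have "\<dots> = g k ^ (q ^ (is ! k)) / L (is ! k) ^ (s ! k) *
        (carlitz_Gamma q \<theta> (s ! k) * L (is ! k) ^ (s ! k) * power_sum (is ! k) (s ! k))"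
      by (simp only: AT_poly_power_sum[OF s[OF k]])
    also have "\<dots> = g k ^ (q ^ (is ! k)) * carlitz_Gamma q \<theta> (s ! k) * power_sum (is ! k) (s ! k)"
      using L_neq_0[of "is ! k"] by simp
    finally show "(\<Sum>j\<in>?J (s ! k). ?f k j) = (g k * carlitz_Gamma q \<theta> (s ! k)) *
        (\<phi> [:\<epsilon> ! k:] ^ (is ! k) * power_sum (is ! k) (s ! k))"
      by (simp add: root_power[OF g[OF k]] mult_ac)
  qed
  also have "\<dots> = (\<Prod>k<length s. g k * carlitz_Gamma q \<theta> (s ! k)) * zeta_term s \<epsilon> is"
    by (simp only: prod.distrib zeta_term_def)
  finally show ?thesis .
qed

text \<open>A leading entry s = 1 with \<epsilon> = 1 contributes just the power sum S_d(1) = 1 /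
  L_d.\<close>

lemma zeta_term_append_ones:
  assumes "length ks = r' + length s" "length \<epsilon> = length s"
  shows "zeta_term (replicate r' 1 @ s) (replicate r' 1 @ \<epsilon>) ks
    = 1 / prod_list (map L (take r' ks)) * zeta_term s \<epsilon> (drop r' ks)"
proof -
  have "prod_list (map L (take r' ks)) = (\<Prod>i<r'. L (ks ! i))"
    using assms by (simp add: prod.list_conv_set_nth atLeast0LessThan)
  moreover have "\<phi> [:1:] = 1"
    using map_one by (simp add: one_pCons)
  ultimately show ?thesis
    using assms
    by (simp add: zeta_term_def prod_lessThan_add nth_append power_sum_1[simplified] prod_dividef)
qed

lemma multi_bernoulli_sum:
  assumes ne: "s \<noteq> []" and s: "\<And>k. k < length s \<Longrightarrow> s ! k \<ge> 1"
    and \<epsilon>: "length \<epsilon> = length s"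
    and g: "\<And>k. k < length s \<Longrightarrow> g k ^ (q - 1) = \<phi> [:\<epsilon> ! k:]"
    and g0: "\<And>k. k < length s \<Longrightarrow> g k \<noteq> 0"
    and zs: "\<And>js. zs js ! 0 = E * fps_const (AT_value s g js 0)"
      "\<And>js k. 0 < k \<Longrightarrow> k < length s \<Longrightarrow> zs js ! k = fps_const (AT_value s g js k)"
  shows "1 / (\<Prod>k<length s. g k * carlitz_Gamma q \<theta> (s ! k)) *
      (\<Sum>js\<in>AT_indices TYPE('a) q s. \<theta> ^ sum_list js *
        (\<Sum>ds\<in>{ds. length ds = r' + 1 \<and> sorted_wrt (>) (N # ds) \<and> last ds \<ge> length s - 1}.
          carlitz_Pi q \<theta> (q ^ last ds - 1) *
            fps_nth (carlitz_polylog q \<theta> s (zs js) / E) (q ^ last ds - 1) /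
          (prod_list (map L ds) * bernoulli_carlitz q \<theta> (q ^ last ds - 1))))
    = (\<Sum>ks | length ks = r' + length s \<and> sorted_wrt (>) (N # ks).
        zeta_term (replicate r' 1 @ s) (replicate r' 1 @ \<epsilon>) ks)"
    (is "1 / ?C * (\<Sum>js\<in>?J. _ js * (\<Sum>ds\<in>?D. ?F js ds)) = _")
proof -
  let ?I = "\<lambda>ds. {is. is \<in> decreasing (length s) \<and> hd is = last ds}"
  have F: "?F js ds = (\<Sum>is\<in>?I ds. 1 / prod_list (map L (butlast ds)) * polylog_coeff s (AT_value s g js) is)"
    if "ds \<in> ?D" for js ds
  proof -
    have "ds \<noteq> []" using that by auto
    \<comment> \<open>The last factor L is isolated to cancel against the Bernoulli-Carlitz number;
      the other indices of \<open>ds\<close> belong to the leading ones, and the last one is shared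
      with i_1.\<close>
    then have L: "prod_list (map L ds) = prod_list (map L (butlast ds)) * L (last ds)"
      by (cases ds rule: rev_cases) auto
    have "carlitz_polylog q \<theta> s (zs js) / E
        = exp_series (\<lambda>d. \<Sum>is | is \<in> decreasing (length s) \<and> hd is = d. polylog_coeff s (AT_value s g js) is)"
      by (simp add: carlitz_polylog_eq[OF ne zs] exp_neq_0)
    then show ?thesis
      using Pi_neq_0 L_neq_0[of "last ds"]
      by (simp add: exp_series_nth bernoulli_carlitz_eq L sum_divide_distrib del: One_nat_def)
  qed
  have C: "?C \<noteq> 0"
    using g0 Pi_neq_0 by (simp add: carlitz_Gamma_def)
  have F': "\<theta> ^ sum_list js * (\<Sum>ds\<in>?D. ?F js ds) = (\<Sum>ds\<in>?D. \<Sum>is\<in>?I ds.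
      1 / prod_list (map L (butlast ds)) * (\<theta> ^ sum_list js * polylog_coeff s (AT_value s g js) is))" for js
    unfolding sum_distrib_left[of _ _ ?D]
  proof (rule sum.cong[OF refl])
    fix ds assume ds: "ds \<in> ?D"
    show "\<theta> ^ sum_list js * ?F js ds = (\<Sum>is\<in>?I ds.
        1 / prod_list (map L (butlast ds)) * (\<theta> ^ sum_list js * polylog_coeff s (AT_value s g js) is))"
      unfolding F[OF ds] sum_distrib_left by (intro sum.cong refl mult.left_commute)
  qed
  have "1 / ?C * (\<Sum>js\<in>?J. \<theta> ^ sum_list js * (\<Sum>ds\<in>?D. ?F js ds))
      = 1 / ?C * (\<Sum>js\<in>?J. \<Sum>ds\<in>?D. \<Sum>is\<in>?I ds. 1 / prod_list (map L (butlast ds)) *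
          (\<theta> ^ sum_list js * polylog_coeff s (AT_value s g js) is))"
    by (simp only: F')
  also have "\<dots> = 1 / ?C * (\<Sum>ds\<in>?D. \<Sum>is\<in>?I ds. 1 / prod_list (map L (butlast ds)) *
          (\<Sum>js\<in>?J. \<theta> ^ sum_list js * polylog_coeff s (AT_value s g js) is))"
    by (simp only: sum.swap[of _ _ ?J] sum_distrib_left)
  also have "\<dots> = (\<Sum>ds\<in>?D. \<Sum>is\<in>?I ds. 1 / prod_list (map L (butlast ds)) * zeta_term s \<epsilon> is)"
    by (subst sum_polylog_coeff[OF s g]) (use C in \<open>simp_all add: sum_distrib_left\<close>)
  also have "\<dots> = (\<Sum>ks | length ks = r' + length s \<and> sorted_wrt (>) (N # ks).
      1 / prod_list (map L (take r' ks)) * zeta_term s \<epsilon> (drop r' ks))"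
    using ne by (intro sum_decreasing_split[symmetric]) (simp add: Suc_leI)
  also have "\<dots> = (\<Sum>ks | length ks = r' + length s \<and> sorted_wrt (>) (N # ks).
      zeta_term (replicate r' 1 @ s) (replicate r' 1 @ \<epsilon>) ks)"
    by (intro sum.cong refl zeta_term_append_ones[symmetric] \<epsilon>) simp
  finally show ?thesis .
qed

end

section \<open>Congruences between fractions\<close>

text \<open>
  Denominators are required to be comaximal with \<open>Q\<close>: this is closed under multiplication by a
  direct computation, without greatest common divisors of polynomials.
\<close>

definition local_fracts :: "'b::field poly \<Rightarrow> 'b poly fract set" where
  "local_fracts Q = {to_fract a / to_fract b |a b. b \<noteq> 0 \<and> (\<exists>u v. u * b + v * Q = 1)}"

definition local_cong :: "'b::field poly \<Rightarrow> 'b poly fract \<Rightarrow> 'b poly fract \<Rightarrow> bool" where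
  "local_cong Q x y \<longleftrightarrow> x \<in> local_fracts Q \<and> y \<in> local_fracts Q \<and> (\<exists>z\<in>local_fracts Q. x - y = to_fract Q * z)"

lemma local_fractsI: "b \<noteq> 0 \<Longrightarrow> u * b + v * Q = 1 \<Longrightarrow> to_fract a / to_fract b \<in> local_fracts Q"
  unfolding local_fracts_def by blast

lemma local_fracts_to_fract: "to_fract a \<in> local_fracts Q"
  using local_fractsI[of 1 1 0 Q a] by simp

lemma comaximal_mult:
  fixes Q :: "'a::comm_ring_1"
  assumes "u * b + v * Q = 1" "u' * d + v' * Q = 1"
  shows "(u * u') * (b * d) + (u * b * v' + v) * Q = 1"
proof -
  have "(u * u') * (b * d) + (u * b * v' + v) * Q = u * b * (u' * d + v' * Q) + v * Q"
    by (simp add: algebra_simps)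
  then show ?thesis using assms by simp
qed

lemma local_fracts_add:
  assumes "x \<in> local_fracts Q" "y \<in> local_fracts Q"
  shows "x + y \<in> local_fracts Q"
proof -
  obtain a b u v where x: "x = to_fract a / to_fract b" "b \<noteq> 0" "u * b + v * Q = 1"
    using assms(1) by (auto simp: local_fracts_def)
  obtain c d u' v' where y: "y = to_fract c / to_fract d" "d \<noteq> 0" "u' * d + v' * Q = 1"
    using assms(2) by (auto simp: local_fracts_def)
  have "x + y = to_fract (a * d + c * b) / to_fract (b * d)"
    using x y by (simp add: add_frac_eq)
  also have "\<dots> \<in> local_fracts Q"
    by (rule local_fractsI[OF _ comaximal_mult[OF x(3) y(3)]]) (use x y in simp)
  finally show ?thesis .
qed

lemma local_fracts_mult:
  assumes "x \<in> local_fracts Q" "y \<in> local_fracts Q"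
  shows "x * y \<in> local_fracts Q"
proof -
  obtain a b u v where x: "x = to_fract a / to_fract b" "b \<noteq> 0" "u * b + v * Q = 1"
    using assms(1) by (auto simp: local_fracts_def)
  obtain c d u' v' where y: "y = to_fract c / to_fract d" "d \<noteq> 0" "u' * d + v' * Q = 1"
    using assms(2) by (auto simp: local_fracts_def)
  have "x * y = to_fract (a * c) / to_fract (b * d)"
    using x y by simp
  also have "\<dots> \<in> local_fracts Q"
    by (rule local_fractsI[OF _ comaximal_mult[OF x(3) y(3)]]) (use x y in simp)
  finally show ?thesis .
qed

lemma local_cong_refl: "x \<in> local_fracts Q \<Longrightarrow> local_cong Q x x"
  using local_fracts_to_fract[of 0 Q] by (auto simp: local_cong_def)

lemma local_cong_add:
  assumes "local_cong Q x y" "local_cong Q x' y'"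
  shows "local_cong Q (x + x') (y + y')"
proof -
  obtain z z' where z: "z \<in> local_fracts Q" "x - y = to_fract Q * z"
      "z' \<in> local_fracts Q" "x' - y' = to_fract Q * z'"
    using assms by (auto simp: local_cong_def)
  have "(x + x') - (y + y') = to_fract Q * (z + z')"
    unfolding distrib_left z(2)[symmetric] z(4)[symmetric] by simp
  then show ?thesis
    using assms z by (auto simp: local_cong_def intro: local_fracts_add)
qed

lemma local_cong_mult:
  assumes "local_cong Q x y" "local_cong Q x' y'"
  shows "local_cong Q (x * x') (y * y')"
proof -
  obtain z z' where z: "z \<in> local_fracts Q" "x - y = to_fract Q * z"
      "z' \<in> local_fracts Q" "x' - y' = to_fract Q * z'"
    using assms by (auto simp: local_cong_def)
  have "x * x' - y * y' = x * (x' - y') + (x - y) * y'"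
    by (simp add: algebra_simps)
  also have "\<dots> = to_fract Q * (x * z' + z * y')"
    unfolding z by (simp add: algebra_simps)
  finally show ?thesis
    using assms z by (auto simp: local_cong_def intro!: local_fracts_add local_fracts_mult)
qed

lemma local_cong_trans:
  assumes "local_cong Q x y" "local_cong Q y w"
  shows "local_cong Q x w"
proof -
  obtain z z' where z: "z \<in> local_fracts Q" "x - y = to_fract Q * z"
      "z' \<in> local_fracts Q" "y - w = to_fract Q * z'"
    using assms by (auto simp: local_cong_def)
  have "x - w = to_fract Q * (z + z')"
    unfolding distrib_left z(2)[symmetric] z(4)[symmetric] by simp
  then show ?thesis
    using assms z by (auto simp: local_cong_def intro: local_fracts_add)
qed

lemma local_cong_power: "local_cong Q x y \<Longrightarrow> local_cong Q (x ^ n) (y ^ n)"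
  using local_fracts_to_fract[of 1 Q]
  by (induction n) (auto intro: local_cong_mult local_cong_refl)

lemma local_cong_prod:
  "(\<And>i. i \<in> S \<Longrightarrow> local_cong Q (g i) (h i)) \<Longrightarrow> local_cong Q (prod g S) (prod h S)"
  using local_fracts_to_fract[of 1 Q]
  by (induction S rule: infinite_finite_induct) (auto intro: local_cong_mult local_cong_refl)

lemma local_cong_sum:
  "(\<And>i. i \<in> S \<Longrightarrow> local_cong Q (g i) (h i)) \<Longrightarrow> local_cong Q (sum g S) (sum h S)"
  using local_fracts_to_fract[of 0 Q]
  by (induction S rule: infinite_finite_induct) (auto intro: local_cong_add local_cong_refl)

lemma local_fracts_integral_at: "x \<in> local_fracts Q \<Longrightarrow> integral_at Q x"
proof -
  have "coprime b Q" if "u * b + v * Q = 1" for u b v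
  proof (rule coprimeI)
    fix c assume "c dvd b" "c dvd Q"
    then have "c dvd u * b + v * Q" by simp
    then show "is_unit c" using that by simp
  qed
  then show "integral_at Q x" if "x \<in> local_fracts Q"
    using that unfolding integral_at_def local_fracts_def by blast
qed

lemma local_cong_fract_cong: "local_cong Q x y \<Longrightarrow> fract_cong Q x y"
  unfolding local_cong_def fract_cong_def using local_fracts_integral_at by blast

text \<open>Euclidean descent: replace a by P mod a, which is nonzero because P is irreducible. The
  result is an explicit identity, so that it can be carried over to F_q'[\<theta>].\<close>

lemma irreducible_comaximal:
  fixes P :: "'a::field poly"
  assumes P: "irreducible P" and "a \<noteq> 0" "degree a < degree P"
  shows "\<exists>u v. u * a + v * P = 1"
  using assms(2,3)
proof (induction "degree a" arbitrary: a rule: less_induct)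
  case less
  show ?case
  proof (cases "degree a = 0")
    case True
    then obtain c where c: "a = [:c:]" by (rule degree_eq_zeroE)
    then have "[:1 / c:] * a + 0 * P = 1" using less.prems by (simp add: one_pCons)
    then show ?thesis by blast
  next
    case False
    define r where "r = P mod a"
    have Pr: "P = P div a * a + r" by (simp add: r_def)
    have "r \<noteq> 0"
    proof
      assume "r = 0"
      then have eq: "P = P div a * a" using Pr by simp
      then have "is_unit (P div a) \<or> is_unit a"
        by (rule irreducibleD[OF P])
      then have "degree (P div a) = 0"
        using False by (auto simp: is_unit_iff_degree less.prems is_unit_poly_iff)
      moreover have "P \<noteq> 0" using P by auto
      ultimately have "degree P = degree a"
        by (metis eq add_0 degree_mult_eq mult_zero_left mult_zero_right)
      then show False using less.prems by simp
    qed
    moreover have "degree r < degree a"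
      using False \<open>r \<noteq> 0\<close> degree_mod_less[of a P] less.prems by (auto simp: r_def)
    ultimately obtain u v where "u * r + v * P = 1"
      using less by fastforce
    moreover have "(- u * (P div a)) * a + (u + v) * P = u * r + v * P"
      unfolding r_def minus_div_mult_eq_mod[symmetric] by (simp add: algebra_simps)
    ultimately have "(- u * (P div a)) * a + (u + v) * P = 1" by simp
    then show ?thesis by blast
  qed
qed

text \<open>Bezout gives existence and uniqueness of the reduced inverse, so the definite
  description has the property it asks for.\<close>

lemma inverse_mod:
  fixes P :: "'a::field poly"
  assumes P: "irreducible P" and a: "a \<noteq> 0" "degree a < degree P"
  shows "(a * inverse_mod P a) mod P = 1 mod P"
proof -
  obtain u v where uv: "u * a + v * P = 1"
    using irreducible_comaximal[OF assms] by blast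
  have "\<exists>!b. b mod P = b \<and> (a * b) mod P = 1 mod P"
  proof (rule ex1I[of _ "u mod P"])
    have "(a * u) mod P = (u * a + v * P) mod P"
      by (simp add: mult.commute)
    then show "u mod P mod P = u mod P \<and> a * (u mod P) mod P = 1 mod P"
      by (simp add: uv mod_mult_right_eq)
  next
    fix b assume b: "b mod P = b \<and> (a * b) mod P = 1 mod P"
    have "b mod P = ((u * a + v * P) * b) mod P"
      by (simp add: uv)
    also have "\<dots> = (u * (a * b)) mod P"
      by (simp add: algebra_simps)
    also have "\<dots> = (u * ((a * b) mod P)) mod P"
      by (simp only: mod_mult_right_eq)
    also have "\<dots> = u mod P"
      using b by (simp add: mod_mult_right_eq)
    finally show "b = u mod P" using b by simp
  qed
  from theI'[OF this] show ?thesis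
    unfolding inverse_mod_def by simp
qed

text \<open>Reducing modulo P and replacing the chosen inverse of a by the genuine fraction 1 / a
  both respect the congruence; each a has degree below that of P and is therefore comaximal with
  it.\<close>

lemma finite_mzv_local_cong:
  fixes P :: "'a::field poly" and h :: "'a \<Rightarrow> 'b::field"
  assumes h: "comm_ring_map h" and inj: "\<And>x. h x = 0 \<Longrightarrow> x = 0" and P: "irreducible P"
  defines "\<phi> \<equiv> \<lambda>p. to_fract (map_poly h p)"
  shows "local_cong (map_poly h P) (\<phi> (finite_mzv s \<epsilon> P))
    (\<Sum>as | length as = length s \<and> (\<forall>a\<in>set as. lead_coeff a = 1) \<and> sorted_wrt (>) (degree P # map degree as).
      \<Prod>i<length s. \<phi> [:\<epsilon> ! i:] ^ degree (as ! i) * (1 / \<phi> (as ! i)) ^ (s ! i))"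
    (is "local_cong ?Q _ (\<Sum>as\<in>?S. ?R as)")
proof -
  interpret h: comm_ring_map h by fact
  interpret m: comm_ring_map "map_poly h" by (rule h.map_poly_map)
  interpret comm_ring_map \<phi>
    unfolding \<phi>_def by (rule comm_ring_map_comp[OF h.map_poly_map comm_ring_map_to_fract])
  have local: "\<phi> p \<in> local_fracts ?Q" for p
    by (simp add: \<phi>_def local_fracts_to_fract)
  have mod: "local_cong ?Q (\<phi> (x mod P)) (\<phi> x)" for x
  proof -
    have "\<phi> x = \<phi> (x div P * P + x mod P)" by simp
    then have "\<phi> (x mod P) - \<phi> x = \<phi> P * \<phi> (- (x div P))"
      by (simp only: map_add map_mult map_uminus) simp
    then show ?thesis
      using local unfolding local_cong_def by (metis \<phi>_def)
  qed
  have inv: "local_cong ?Q (\<phi> (inverse_mod P a)) (1 / \<phi> a)" if a: "a \<noteq> 0" "degree a < degree P" for a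
  proof -
    obtain u v where "u * a + v * P = 1"
      using irreducible_comaximal[OF P a] by blast
    then have uv: "map_poly h u * map_poly h a + map_poly h v * ?Q = 1"
      by (simp flip: m.map_mult m.map_add add: m.map_one)
    have a0: "map_poly h a \<noteq> 0"
      using a inj by (subst map_poly_eq_0_iff) (auto simp: h.map_zero)
    have div: "x / \<phi> a \<in> local_fracts ?Q" if "x \<in> range \<phi>" for x
      using that local_fractsI[OF a0 uv] by (auto simp: \<phi>_def)
    \<comment> \<open>The two remainders modulo P agree, so a times its inverse differs from 1 by P
      times the difference of the quotients.\<close>
    define c where "c = (a * inverse_mod P a) div P - 1 div P"
    have "a * inverse_mod P a = 1 + P * c"
      using inverse_mod[OF P a] unfolding c_def right_diff_distrib
      by (metis add.commute add_diff_eq diff_add_eq minus_mod_eq_mult_div mult_div_mod_eq add_diff_cancel_left')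
    then have "\<phi> a * \<phi> (inverse_mod P a) = 1 + \<phi> P * \<phi> c"
      by (metis map_add map_mult map_one)
    then have "\<phi> (inverse_mod P a) - 1 / \<phi> a = to_fract ?Q * (\<phi> c / \<phi> a)"
      using a0 by (simp add: \<phi>_def field_simps)
    then show ?thesis
      using local div[of 1] div[of "\<phi> c"] map_one unfolding local_cong_def by (metis rangeI)
  qed
  let ?X = "\<Sum>as\<in>?S. \<Prod>i<length s. [:\<epsilon> ! i:] ^ degree (as ! i) * inverse_mod P (as ! i) ^ (s ! i)"
  have "finite_mzv s \<epsilon> P = ?X mod P"
    by (simp only: finite_mzv_def)
  then have "local_cong ?Q (\<phi> (finite_mzv s \<epsilon> P)) (\<phi> ?X)"
    using mod by simp
  moreover have "local_cong ?Q (\<phi> ?X) (\<Sum>as\<in>?S. ?R as)"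
    unfolding map_sum map_prod map_mult map_power
  proof (intro local_cong_sum local_cong_prod local_cong_mult local_cong_power local_cong_refl[OF local])
    fix as i assume as: "as \<in> ?S" and "i \<in> {..<length s}"
    then have "as ! i \<in> set as" by auto
    then have "lead_coeff (as ! i) = 1" "degree (as ! i) < degree P"
      using as by auto
    then show "local_cong ?Q (\<phi> (inverse_mod P (as ! i))) (1 / \<phi> (as ! i))"
      by (intro inv) auto
  qed
  ultimately show ?thesis by (rule local_cong_trans)
qed

section \<open>The embedding of the rational function fields\<close>

text \<open>Translation by 1 permutes the field, so the sum of all elements shows that the
  cardinality vanishes in it; the characteristic is a prime dividing p^n.\<close>

lemma CHAR_finite_field:
  assumes "prime p" and card: "CARD('a::{field,finite}) = p ^ n"
  shows "CHAR('a) = p"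
proof -
  have "(\<Sum>x\<in>UNIV. x + 1) = (\<Sum>x\<in>(UNIV::'a set). x)"
    by (rule sum.reindex_bij_witness[of _ "\<lambda>x. x - 1" "\<lambda>x. x + 1"]) auto
  then have "of_nat CARD('a) = (0::'a)"
    by (simp add: sum.distrib)
  then have "CHAR('a) dvd p ^ n"
    by (simp only: of_nat_eq_0_iff_char_dvd card)
  moreover have "prime CHAR('a)"
    by (rule prime_CHAR_semidom) (rule finite_imp_CHAR_pos, simp)
  ultimately show ?thesis
    using assms(1) by (metis prime_dvd_power primes_dvd_imp_eq)
qed

lemma CHAR_poly_fract: "CHAR('b::field poly fract) = CHAR('b)"
proof (rule CHAR_eqI)
  have of_nat: "of_nat n = to_fract (of_nat n :: 'b poly)" for n
    by (induction n) simp_all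
  show "of_nat CHAR('b) = (0 :: 'b poly fract)"
    unfolding of_nat using of_nat_CHAR[where 'a = "'b poly"] by simp
  show "CHAR('b) dvd n" if "of_nat n = (0 :: 'b poly fract)" for n
    using that unfolding of_nat by (simp add: of_nat_eq_0_iff_char_dvd)
qed

lemma carlitz_embedding_poly_fract:
  fixes \<iota> :: "'a::{field,finite} \<Rightarrow> 'b::{field,finite}"
  assumes "prime p" "e \<ge> 1" "q = p ^ e" "CARD('a) = q" "CARD('b) = q ^ (q - 1)" "field_embedding \<iota>"
  shows "carlitz_embedding q theta_frac (\<lambda>p. to_fract (map_poly \<iota> p))"
proof -
  interpret \<iota>: comm_ring_map \<iota>
    using assms(6) by unfold_locales (simp_all add: field_embedding_def)
  have inj: "x = 0" if "\<iota> x = 0" for x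
  proof (rule ccontr)
    assume "x \<noteq> 0"
    then have "\<iota> x * \<iota> (1 / x) = 1" by (simp flip: \<iota>.map_mult add: \<iota>.map_one)
    then show False using that by simp
  qed
  have q: "q \<ge> 2"
    using assms(1-3) prime_ge_2_nat[of p] power_increasing[of 1 e p] by simp
  have char: "CHAR('b poly fract) = p"
    using CHAR_finite_field[OF assms(1), where 'a = 'b] assms(3,5)
    by (simp add: CHAR_poly_fract flip: power_mult)
  show ?thesis
  proof (intro carlitz_embedding.intro carlitz_field.intro carlitz_embedding_axioms.intro)
    show "comm_ring_map (\<lambda>p. to_fract (map_poly \<iota> p))"
      by (rule comm_ring_map_comp[OF \<iota>.map_poly_map comm_ring_map_to_fract])
    show "carlitz_bracket q (theta_frac :: 'b poly fract) n \<noteq> 0" if "n > 0" for n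
      using bracket_monom_neq_0[OF q that, where 'a = 'b]
      by (simp add: theta_frac_def flip: comm_ring_map.map_bracket[OF comm_ring_map_to_fract])
    show "to_fract (map_poly \<iota> [:0, 1:]) = theta_frac"
      by (simp add: theta_frac_def map_poly_pCons \<iota>.map_zero \<iota>.map_one)
    show "to_fract (map_poly \<iota> x) = 0 \<Longrightarrow> x = 0" for x
      using inj \<iota>.map_zero by (auto simp: poly_eq_iff coeff_map_poly)
  qed (use assms char in auto)
qed

theorem theorem3p11:
  fixes p e q :: nat
    and \<iota> :: "'a::{field,finite} \<Rightarrow> 'b::{field,finite}"
    and s :: "nat list" and \<epsilon> :: "'a list" and \<gamma> :: "'b list"
  assumes "prime p" and "e \<ge> 1" and "q = p ^ e"
    and "CARD('a) = q" and "CARD('b) = q ^ (q - 1)"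
    and "field_embedding \<iota>"
    and "length s \<ge> 1" and "length \<epsilon> = length s" and "length \<gamma> = length s"
    and "\<forall>i<length s. s ! i \<ge> 1"
    and "\<forall>i<length s. \<epsilon> ! i \<noteq> 0"
    and "\<forall>i<length s. (\<gamma> ! i) ^ (q - 1) = \<iota> (\<epsilon> ! i)"
  shows
    "(\<forall>P :: 'a poly. lead_coeff P = 1 \<and> irreducible P \<and>
        (\<forall>i<length s. \<not> P dvd carlitz_Gamma q [:0, 1:] (s ! i)) \<longrightarrow>
        fract_cong (map_poly \<iota> P)
          (to_fract (map_poly \<iota> (finite_mzv s \<epsilon> P)))
          (1 / (\<Prod>i<length s. to_fract [:\<gamma> ! i:] * carlitz_Gamma q theta_frac (s ! i)) *
           (\<Sum>js\<in>AT_indices TYPE('a) q s. theta_frac ^ sum_list js *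
             (\<Sum>d = length s - 1..degree P - 1.
                multi_bernoulli_carlitz q \<iota> s \<gamma> js (q ^ d - 1) /
                (carlitz_L q theta_frac d * bernoulli_carlitz q theta_frac (q ^ d - 1)))))) \<and>
     (\<forall>r'. \<forall>P :: 'a poly. lead_coeff P = 1 \<and> irreducible P \<and>
        (\<forall>i<length s. \<not> P dvd carlitz_Gamma q [:0, 1:] (s ! i)) \<longrightarrow>
        fract_cong (map_poly \<iota> P)
          (to_fract (map_poly \<iota> (finite_mzv (replicate r' 1 @ s) (replicate r' 1 @ \<epsilon>) P)))
          (1 / (\<Prod>i<length s. to_fract [:\<gamma> ! i:] * carlitz_Gamma q theta_frac (s ! i)) *
           (\<Sum>js\<in>AT_indices TYPE('a) q s. theta_frac ^ sum_list js *
             (\<Sum>ds\<in>{ds. length ds = r' + 1 \<and> sorted_wrt (>) (degree P # ds) \<and>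
                         last ds \<ge> length s - 1}.
                multi_bernoulli_carlitz q \<iota> s \<gamma> js (q ^ last ds - 1) /
                (prod_list (map (carlitz_L q theta_frac) ds) *
                 bernoulli_carlitz q theta_frac (q ^ last ds - 1))))))"
proof -
  let ?\<theta> = "theta_frac :: 'b poly fract"
  let ?\<phi> = "\<lambda>p. to_fract (map_poly \<iota> p)"
  interpret carlitz_embedding q ?\<theta> ?\<phi>
    by (rule carlitz_embedding_poly_fract[OF assms(1-6)])
  interpret \<iota>: comm_ring_map \<iota>
    using assms(6) by unfold_locales (simp_all add: field_embedding_def)
  have inj: "x = 0" if "\<iota> x = 0" for x
    using map_eq_0[of "[:x:]"] that by (simp add: map_poly_pCons \<iota>.map_zero)
  have ne: "s \<noteq> []" using assms(7) by auto
  define g where "g k = to_fract [:\<gamma> ! k:]" for k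
  have g: "g k ^ (q - 1) = ?\<phi> [:\<epsilon> ! k:]" if "k < length s" for k
  proof -
    have "g k ^ (q - 1) = to_fract ([:\<gamma> ! k:] ^ (q - 1))"
      by (simp add: g_def comm_ring_map.map_power[OF comm_ring_map_to_fract])
    also have "\<dots> = ?\<phi> [:\<epsilon> ! k:]"
      using assms(12) that by (simp add: poly_const_pow map_poly_pCons \<iota>.map_zero)
    finally show ?thesis .
  qed
  have g0: "g k \<noteq> 0" if "k < length s" for k
  proof
    assume "g k = 0"
    then have "?\<phi> [:\<epsilon> ! k:] = 0"
      using g[OF that] q_ge_2 by (simp add: zero_power)
    then have "\<epsilon> ! k = 0" using map_eq_0 by force
    then show False using assms(11) that by simp
  qed
  define zs where "zs js = map (\<lambda>i. if i = 0 then E * fps_const (AT_value s g js i)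
      else fps_const (AT_value s g js i)) [0..<length s]" for js
  have BC: "multi_bernoulli_carlitz q \<iota> s \<gamma> js n
      = carlitz_Pi q ?\<theta> n * fps_nth (carlitz_polylog q ?\<theta> s (zs js) / E) n" for js n
  proof -
    have "to_fract (smult c p) = to_fract [:c:] * to_fract p" for c :: 'b and p
      by (simp flip: to_fract_mult)
    then show ?thesis
      by (simp only: multi_bernoulli_carlitz_def Let_def zs_def g_def cong: if_cong)
  qed
  \<comment> \<open>This is part (2). For r' = 0 the index lists are singletons, which yields part
    (1).\<close>
  have main: "fract_cong (map_poly \<iota> P)
          (?\<phi> (finite_mzv (replicate r' 1 @ s) (replicate r' 1 @ \<epsilon>) P))
          (1 / (\<Prod>i<length s. to_fract [:\<gamma> ! i:] * carlitz_Gamma q ?\<theta> (s ! i)) *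
           (\<Sum>js\<in>AT_indices TYPE('a) q s. ?\<theta> ^ sum_list js *
             (\<Sum>ds\<in>{ds. length ds = r' + 1 \<and> sorted_wrt (>) (degree P # ds) \<and>
                         last ds \<ge> length s - 1}.
                multi_bernoulli_carlitz q \<iota> s \<gamma> js (q ^ last ds - 1) /
                (prod_list (map (carlitz_L q ?\<theta>) ds) *
                 bernoulli_carlitz q ?\<theta> (q ^ last ds - 1)))))" (is "fract_cong _ _ ?rhs")
    if P: "irreducible P" for r' and P :: "'a poly"
  proof -
    let ?s = "replicate r' 1 @ s" and ?\<epsilon> = "replicate r' 1 @ \<epsilon>"
    have "?rhs = (\<Sum>ks | length ks = r' + length s \<and> sorted_wrt (>) (degree P # ks). zeta_term ?s ?\<epsilon> ks)"
      unfolding BC g_def[symmetric]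
      by (rule multi_bernoulli_sum[OF ne _ assms(8) g g0]) (use assms(10) ne in \<open>auto simp: zs_def\<close>)
    also have "\<dots> = (\<Sum>as | length as = length ?s \<and> (\<forall>a\<in>set as. lead_coeff a = 1) \<and>
        sorted_wrt (>) (degree P # map degree as).
        \<Prod>i<length ?s. ?\<phi> [:?\<epsilon> ! i:] ^ degree (as ! i) * (1 / ?\<phi> (as ! i)) ^ (?s ! i))"
      unfolding zeta_term_def by (subst sum_monic_lists[OF refl]) simp
    finally show ?thesis
      using finite_mzv_local_cong[OF \<iota>.comm_ring_map_axioms inj P, of ?s ?\<epsilon>]
      by (simp only: local_cong_fract_cong)
  qed
  show ?thesis
  proof (intro conjI allI impI; elim conjE)
    fix P :: "'a poly"
    assume P: "irreducible P"
    \<comment> \<open>With truncated subtraction, d \<le> degree P - 1 means d < degree P only for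
      positive degree.\<close>
    have deg: "degree P > 0"
      using P by (metis is_unit_iff_degree irreducible_def gr0I)
    let ?t = "\<lambda>js d. multi_bernoulli_carlitz q \<iota> s \<gamma> js (q ^ d - 1) /
                (carlitz_L q ?\<theta> d * bernoulli_carlitz q ?\<theta> (q ^ d - 1))"
    have "(\<Sum>ds\<in>{ds. length ds = 0 + 1 \<and> sorted_wrt (>) (degree P # ds) \<and> last ds \<ge> length s - 1}.
        multi_bernoulli_carlitz q \<iota> s \<gamma> js (q ^ last ds - 1) /
        (prod_list (map (carlitz_L q ?\<theta>) ds) * bernoulli_carlitz q ?\<theta> (q ^ last ds - 1)))
      = (\<Sum>d = length s - 1..degree P - 1. ?t js d)" for js
      by (rule sum.reindex_bij_witness[of _ "\<lambda>d. [d]" last])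
        (use deg in \<open>auto simp: length_Suc_conv\<close>)
    then show "fract_cong (map_poly \<iota> P) (?\<phi> (finite_mzv s \<epsilon> P))
        (1 / (\<Prod>i<length s. to_fract [:\<gamma> ! i:] * carlitz_Gamma q ?\<theta> (s ! i)) *
         (\<Sum>js\<in>AT_indices TYPE('a) q s. ?\<theta> ^ sum_list js *
           (\<Sum>d = length s - 1..degree P - 1. ?t js d)))"
      using main[OF P, of 0] by (simp only: replicate_0 append_Nil)
  next
    fix r' and P :: "'a poly"
    assume "irreducible P"
    then show "fract_cong (map_poly \<iota> P)
          (?\<phi> (finite_mzv (replicate r' 1 @ s) (replicate r' 1 @ \<epsilon>) P))
          (1 / (\<Prod>i<length s. to_fract [:\<gamma> ! i:] * carlitz_Gamma q ?\<theta> (s ! i)) *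
           (\<Sum>js\<in>AT_indices TYPE('a) q s. ?\<theta> ^ sum_list js *
             (\<Sum>ds\<in>{ds. length ds = r' + 1 \<and> sorted_wrt (>) (degree P # ds) \<and>
                         last ds \<ge> length s - 1}.
                multi_bernoulli_carlitz q \<iota> s \<gamma> js (q ^ last ds - 1) /
                (prod_list (map (carlitz_L q ?\<theta>) ds) *
                 bernoulli_carlitz q ?\<theta> (q ^ last ds - 1)))))"
      by (rule main)
  qed
qed

end
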